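(* Let $m\ge n\ge 1$ be integers and $l=m+n$. There exist constants $K$, $c_1$, $c_2$ depending only on $m$ and $n$ (and not on the data $A,B,C,f$ or on the machine precision $\varepsilon_M$) such that the following holds. Let $A\in\mathbb{R}^{m\times m}$ be symmetric positive definite, let $C\in\mathbb{R}^{n\times n}$ be symmetric positive semidefinite, let $B\in\mathbb{R}^{m\times n}$ have rank $n$, and put $$M=\begin{pmatrix}A&B\\ B^T&-C\end{pmatrix}\in\mathbb{R}^{l\times l},\qquad f\in\mathbb{R}^l .$$ Suppose $\varepsilon_M\,K\,\kappa(M)<1$. Let $\tilde z$ be the vector computed in floating point arithmetic with machine precision $\varepsilon_M$ by the BCGS2 solution method for $Mz=f$ (described in the context). Then $\tilde z$ is a backward stable solution of $Mz=f$: there exist $\Delta M\in\mathbb{R}^{l\times l}$ and $\Delta f\in\mathbb{R}^l$ with $$(M+\Delta M)\tilde z=f+\Delta f,\qquad \|\Delta M\|\le \varepsilon_M c_1\|M\|,\qquad \|\Delta f\|\le\varepsilon_M c_2\|f\| .$$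
   Context: Here $\|\cdot\|$ is the Euclidean norm of vectors and the induced (spectral) norm of matrices, and $\kappa(M)=\|M^{-1}\|\,\|M\|$. Floating point arithmetic is the standard model with machine precision $\varepsilon_M$ (each basic operation is performed with relative error at most $\varepsilon_M$, with no overflow or underflow), and matrix products are computed conventionally. Thin Householder Q-R: for $X\in\mathbb{R}^{l\times k}$, $l\ge k=\operatorname{rank}(X)$, this routine produces $Q\in\mathbb{R}^{l\times k}$ with $Q^TQ=I$ and upper triangular $R\in\mathbb{R}^{k\times k}$ with $X=QR$. In floating point arithmetic the computed factors $\tilde Q,\tilde R$ satisfy $\|I-\tilde Q^T\tilde Q\|\le\varepsilon_M L$ and $X+\Delta X=\tilde Q\tilde R$ with $\|\Delta X\|\le\varepsilon_M L\|X\|$, for a constant $L=L(l,k)$. BCGS2 (Reorthogonalized Block Classical Gram–Schmidt) factorization of $M=(M_1,M_2)$, where $M_1=\begin{pmatrix}A\\ B^T\end{pmatrix}\in\mathbb{R}^{l\times m}$ and $M_2=\begin{pmatrix}B\\ -C\end{pmatrix}\in\mathbb{R}^{l\times n}$: 1. $M_1=Q_1R_1$ (thin Householder Q-R). 2. $S_1=Q_1^TM_2$ and $Y_1=M_2-Q_1S_1$. 3. $Y_1=Q_2R_2$ (thin Householder Q-R). 4. $S_2=Q_1^TQ_2$ and $Y_2=Q_2-Q_1S_2$. 5. $Y_2=Q_2^{(new)}\bar R_2$ (thin Householder Q-R). 6. $S^{(new)}=S_1+S_2R_2$ and $R_2^{(new)}=\bar R_2R_2$. 7. Output $Q=(Q_1,Q_2^{(new)})$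 and $R=\begin{pmatrix}R_1&S^{(new)}\\0&R_2^{(new)}\end{pmatrix}$. BCGS2 solution method for $Mz=f$: compute the factors $Q,R$ of $M$ by BCGS2, compute $g=Q^Tf$, and then solve the upper triangular system $Rz=g$ by back-substitution. *)

theory Defs
  imports "HOL-Analysis.Analysis"
begin

section \<open>Matrices\<close>

text \<open>The spectral norm; \<open>norm\<close> on type \<open>real^'n^'m\<close> would be the Frobenius norm.\<close>

definition spnorm :: "real^'n^'m \<Rightarrow> real" where
  "spnorm A = onorm (\<lambda>x. A *v x)"

definition cond_num :: "real^'n^'n \<Rightarrow> real" where
  "cond_num A = spnorm (matrix_inv A) * spnorm A"

definition sym_pos_def :: "real^'n^'n \<Rightarrow> bool" where
  "sym_pos_def A \<longleftrightarrow> transpose A = A \<and> (\<forall>x. x \<noteq> 0 \<longrightarrow> x \<bullet> (A *v x) > 0)"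

definition sym_pos_semidef :: "real^'n^'n \<Rightarrow> bool" where
  "sym_pos_semidef A \<longleftrightarrow> transpose A = A \<and> (\<forall>x. x \<bullet> (A *v x) \<ge> 0)"

definition upper_triangular :: "real^('n::{finite,linorder})^('n::{finite,linorder}) \<Rightarrow> bool" where
  "upper_triangular R \<longleftrightarrow> (\<forall>i j. j < i \<longrightarrow> R $ i $ j = 0)"

text \<open>Block matrices are indexed by sum types, \<open>Inl\<close> indices preceding \<open>Inr\<close> indices.\<close>

instantiation sum :: (linorder, linorder) linorder
begin

definition less_eq_sum :: "'a + 'b \<Rightarrow> 'a + 'b \<Rightarrow> bool" where
  "x \<le> y \<longleftrightarrow> (case (x, y) of
      (Inl a, Inl b) \<Rightarrow> a \<le> b
    | (Inl a, Inr b) \<Rightarrow> True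
    | (Inr a, Inl b) \<Rightarrow> False
    | (Inr a, Inr b) \<Rightarrow> a \<le> b)"

definition less_sum :: "'a + 'b \<Rightarrow> 'a + 'b \<Rightarrow> bool" where
  "x < y \<longleftrightarrow> x \<le> y \<and> \<not> y \<le> (x :: 'a + 'b)"

instance
  by standard (auto simp: less_eq_sum_def less_sum_def split: sum.splits)

end

definition hcat :: "real^'m^'l \<Rightarrow> real^'n^'l \<Rightarrow> real^('m + 'n)^'l" where
  "hcat X Y = (\<chi> i j. case j of Inl a \<Rightarrow> X $ i $ a | Inr b \<Rightarrow> Y $ i $ b)"

definition vcat :: "real^'n^'k \<Rightarrow> real^'n^'l \<Rightarrow> real^'n^('k + 'l)" where
  "vcat X Y = (\<chi> i. case i of Inl a \<Rightarrow> X $ a | Inr b \<Rightarrow> Y $ b)"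

definition block_mat ::
  "real^'m^'k \<Rightarrow> real^'n^'k \<Rightarrow> real^'m^'l \<Rightarrow> real^'n^'l \<Rightarrow> real^('m + 'n)^('k + 'l)" where
  "block_mat A B C D = hcat (vcat A C) (vcat B D)"


section \<open>Floating point arithmetic\<close>

text \<open>The standard model is rendered by relations between exact inputs and possible computed
  outputs. \<open>fl \<epsilon> x y\<close> says that \<open>y\<close> is a possible computed value of a basic operation
  whose exact result is \<open>x\<close>. Where an operation breaks down (division by zero, rank-deficient
  input to the thin Q-R routine), every output is admitted, so that a theorem about
  all possible outputs also has to exclude the breakdown.\<close>

definition fl :: "real \<Rightarrow> real \<Rightarrow> real \<Rightarrow> bool" where
  "fl \<epsilon> x y \<longleftrightarrow> (\<exists>\<delta>. \<bar>\<delta>\<bar> \<le> \<epsilon> \<and> y = x * (1 + \<delta>))"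

definition fl_div :: "real \<Rightarrow> real \<Rightarrow> real \<Rightarrow> real \<Rightarrow> bool" where
  "fl_div \<epsilon> x y z \<longleftrightarrow> (y \<noteq> 0 \<longrightarrow> fl \<epsilon> (x / y) z)"

text \<open>\<open>fl_sum \<epsilon> t I s\<close>: \<open>s\<close> is a possible computed value of \<open>\<Sum>i\<in>I. t i\<close>, with the
  additions carried out in any order and with any bracketing.\<close>

inductive fl_sum :: "real \<Rightarrow> ('a \<Rightarrow> real) \<Rightarrow> 'a set \<Rightarrow> real \<Rightarrow> bool" for \<epsilon> t where
  single: "fl_sum \<epsilon> t {i} (t i)"
| add: "\<lbrakk>fl_sum \<epsilon> t I x; fl_sum \<epsilon> t J y; I \<inter> J = {}; fl \<epsilon> (x + y) s\<rbrakk>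
    \<Longrightarrow> fl_sum \<epsilon> t (I \<union> J) s"

definition fl_inner :: "real \<Rightarrow> real^'k \<Rightarrow> real^'k \<Rightarrow> real \<Rightarrow> bool" where
  "fl_inner \<epsilon> x y s \<longleftrightarrow> (\<exists>p. (\<forall>i. fl \<epsilon> (x $ i * y $ i) (p i)) \<and> fl_sum \<epsilon> p UNIV s)"

definition fl_mat_mult :: "real \<Rightarrow> real^'k^'m \<Rightarrow> real^'n^'k \<Rightarrow> real^'n^'m \<Rightarrow> bool" where
  "fl_mat_mult \<epsilon> X Y Z \<longleftrightarrow> (\<forall>i j. fl_inner \<epsilon> (row i X) (column j Y) (Z $ i $ j))"

definition fl_mat_vec :: "real \<Rightarrow> real^'k^'m \<Rightarrow> real^'k \<Rightarrow> real^'m \<Rightarrow> bool" where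
  "fl_mat_vec \<epsilon> X y z \<longleftrightarrow> (\<forall>i. fl_inner \<epsilon> (row i X) y (z $ i))"

definition fl_mat_add :: "real \<Rightarrow> real^'n^'m \<Rightarrow> real^'n^'m \<Rightarrow> real^'n^'m \<Rightarrow> bool" where
  "fl_mat_add \<epsilon> X Y Z \<longleftrightarrow> (\<forall>i j. fl \<epsilon> (X $ i $ j + Y $ i $ j) (Z $ i $ j))"

definition fl_mat_diff :: "real \<Rightarrow> real^'n^'m \<Rightarrow> real^'n^'m \<Rightarrow> real^'n^'m \<Rightarrow> bool" where
  "fl_mat_diff \<epsilon> X Y Z \<longleftrightarrow> (\<forall>i j. fl \<epsilon> (X $ i $ j - Y $ i $ j) (Z $ i $ j))"

text \<open>Back-substitution for \<open>R z = g\<close>: component \<open>i\<close> is the computed value of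
  \<open>(g\<^sub>i - (\<Sum>j>i. r\<^sub>i\<^sub>j z\<^sub>j)) / r\<^sub>i\<^sub>i\<close>, where \<open>p j\<close> is the computed product
  \<open>r\<^sub>i\<^sub>j z\<^sub>j\<close> and the numerator is summed in any order. Entries of \<open>R\<close> below the
  diagonal are not referenced.\<close>

definition fl_back_subst ::
  "real \<Rightarrow> real^('l::{finite,linorder})^('l::{finite,linorder}) \<Rightarrow> real^('l::{finite,linorder})
    \<Rightarrow> real^('l::{finite,linorder}) \<Rightarrow> bool" where
  "fl_back_subst \<epsilon> R g z \<longleftrightarrow>
    (\<forall>i. \<exists>p s. (\<forall>j>i. fl \<epsilon> (R $ i $ j * z $ j) (p j)) \<and>
      fl_sum \<epsilon> (\<lambda>j. if j = i then g $ i else - p j) {i..} s \<and>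
      fl_div \<epsilon> s (R $ i $ i) (z $ i))"

text \<open>The thin Householder Q-R routine enters through its known floating point error bounds,
  with constant \<open>L l k\<close> for \<open>l \<times> k\<close> inputs of full column rank.\<close>

definition fl_thin_qr ::
  "real \<Rightarrow> (nat \<Rightarrow> nat \<Rightarrow> real) \<Rightarrow> real^('k::{finite,linorder})^'l
    \<Rightarrow> real^('k::{finite,linorder})^'l \<Rightarrow> real^('k::{finite,linorder})^('k::{finite,linorder}) \<Rightarrow> bool" where
  "fl_thin_qr \<epsilon> L X Q R \<longleftrightarrow>
    (rank X = CARD('k) \<longrightarrow>
      upper_triangular R \<and>
      spnorm (mat 1 - transpose Q ** Q) \<le> \<epsilon> * L CARD('l) CARD('k) \<and>
      (\<exists>\<Delta>X. X + \<Delta>X = Q ** R \<and> spnorm \<Delta>X \<le> \<epsilon> * L CARD('l) CARD('k) * spnorm X))"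


section \<open>BCGS2\<close>

definition fl_bcgs2 ::
  "real \<Rightarrow> (nat \<Rightarrow> nat \<Rightarrow> real) \<Rightarrow> real^('m::{finite,linorder})^'l \<Rightarrow> real^('n::{finite,linorder})^'l
    \<Rightarrow> real^('m::{finite,linorder} + 'n::{finite,linorder})^'l
    \<Rightarrow> real^('m::{finite,linorder} + 'n::{finite,linorder})^('m::{finite,linorder} + 'n::{finite,linorder}) \<Rightarrow> bool" where
  "fl_bcgs2 \<epsilon> L M\<^sub>1 M\<^sub>2 Q R \<longleftrightarrow>
    (\<exists>Q\<^sub>1 R\<^sub>1 S\<^sub>1 P\<^sub>1 Y\<^sub>1 Q\<^sub>2 R\<^sub>2 S\<^sub>2 P\<^sub>2 Y\<^sub>2 Q\<^sub>2' R\<^sub>2b P\<^sub>3 S' R\<^sub>2'.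
      fl_thin_qr \<epsilon> L M\<^sub>1 Q\<^sub>1 R\<^sub>1 \<and>
      fl_mat_mult \<epsilon> (transpose Q\<^sub>1) M\<^sub>2 S\<^sub>1 \<and>
      fl_mat_mult \<epsilon> Q\<^sub>1 S\<^sub>1 P\<^sub>1 \<and> fl_mat_diff \<epsilon> M\<^sub>2 P\<^sub>1 Y\<^sub>1 \<and>
      fl_thin_qr \<epsilon> L Y\<^sub>1 Q\<^sub>2 R\<^sub>2 \<and>
      fl_mat_mult \<epsilon> (transpose Q\<^sub>1) Q\<^sub>2 S\<^sub>2 \<and>
      fl_mat_mult \<epsilon> Q\<^sub>1 S\<^sub>2 P\<^sub>2 \<and> fl_mat_diff \<epsilon> Q\<^sub>2 P\<^sub>2 Y\<^sub>2 \<and>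
      fl_thin_qr \<epsilon> L Y\<^sub>2 Q\<^sub>2' R\<^sub>2b \<and>
      fl_mat_mult \<epsilon> S\<^sub>2 R\<^sub>2 P\<^sub>3 \<and> fl_mat_add \<epsilon> S\<^sub>1 P\<^sub>3 S' \<and>
      fl_mat_mult \<epsilon> R\<^sub>2b R\<^sub>2 R\<^sub>2' \<and>
      Q = hcat Q\<^sub>1 Q\<^sub>2' \<and>
      R = block_mat R\<^sub>1 S' 0 R\<^sub>2')"

definition fl_bcgs2_solve ::
  "real \<Rightarrow> (nat \<Rightarrow> nat \<Rightarrow> real) \<Rightarrow> real^('m::{finite,linorder})^('m::{finite,linorder} + 'n::{finite,linorder})
    \<Rightarrow> real^('n::{finite,linorder})^('m::{finite,linorder} + 'n::{finite,linorder})
    \<Rightarrow> real^('m::{finite,linorder} + 'n::{finite,linorder}) \<Rightarrow> real^('m::{finite,linorder} + 'n::{finite,linorder}) \<Rightarrow> bool" where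
  "fl_bcgs2_solve \<epsilon> L M\<^sub>1 M\<^sub>2 f z \<longleftrightarrow>
    (\<exists>Q R g. fl_bcgs2 \<epsilon> L M\<^sub>1 M\<^sub>2 Q R \<and>
      fl_mat_vec \<epsilon> (transpose Q) f g \<and> fl_back_subst \<epsilon> R g z)"

end

theory Submission
  imports Defs
begin

text \<open>
  A solution method that factorizes \<open>M = Q R\<close>, forms \<open>transpose Q f\<close> and back-substitutes is backward
  stable as soon as the computed factors satisfy two properties: the residual \<open>Q R - M\<close> is of order
  \<open>\<epsilon> \<parallel>M\<parallel>\<close>, and \<open>Q\<close> is orthonormal up to \<open>O(\<epsilon>)\<close>. The reduction is \<open>solve_backward_error\<close>; the matrix is
  square, so \<open>Q\<close> times its transpose is then also close to the identity.

  For BCGS2 the residual is small because the errors of the steps merely accumulate. Orthogonality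
  is the delicate part. Write \<open>\<mu> = \<parallel>M\<parallel>\<close> and let \<open>\<sigma>\<close> be the smallest singular value of \<open>M\<close>. A block
  Gram-Schmidt projection makes \<open>Y\<close> orthogonal to \<open>Q\<^sub>1\<close> up to an absolute error of order \<open>\<epsilon>\<close> times
  the norm of the projected block (\<open>projection_step\<close>), and normalizing \<open>Y\<close> divides this error by the
  smallest singular value of \<open>Y\<close> (\<open>qr_step\<close>). In the first pass \<open>Y\<^sub>1\<close> has singular values at least
  \<open>\<sigma> / 2\<close>, so \<open>Q\<^sub>2\<close> is orthogonal to \<open>Q\<^sub>1\<close> only up to \<open>\<epsilon> \<mu> / \<sigma>\<close>, which the hypothesis on the condition
  number makes at most \<open>1/100\<close>. In the second pass the projected block \<open>Q\<^sub>2\<close> has norm \<open>O(1)\<close> and is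
  already nearly orthogonal to \<open>Q\<^sub>1\<close>; its projection keeps singular values at least \<open>1/4\<close>, and the
  same two lemmas now give orthogonality up to \<open>O(\<epsilon>)\<close>. This is \<open>fl_bcgs2_error\<close>. The lower bounds on
  singular values also show that every input of the Q-R routine has full rank and that the diagonal
  of \<open>R\<close> does not vanish, so no step breaks down. The saddle point structure enters through the
  invertibility of \<open>M\<close> (\<open>saddle_point_invertible\<close>), which makes \<open>\<sigma>\<close> positive.
\<close>

section \<open>Spectral norm\<close>

lemma norm_matrix_vector_le: "norm (A *v x) \<le> spnorm A * norm x"
  unfolding spnorm_def by (rule onorm) simp

lemma spnorm_nonneg: "0 \<le> spnorm A"
  unfolding spnorm_def by (rule onorm_pos_le) simp

lemma spnorm_leI: "(\<And>x. norm (A *v x) \<le> b * norm x) \<Longrightarrow> spnorm A \<le> b"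
  unfolding spnorm_def by (rule onorm_le)

lemma spnorm_add_le:
  assumes "spnorm A \<le> a" "spnorm B \<le> b"
  shows "spnorm (A + B) \<le> a + b"
proof -
  have "spnorm (A + B) \<le> spnorm A + spnorm B"
    using onorm_triangle[of "(*v) A" "(*v) B"]
    by (simp add: spnorm_def matrix_vector_mult_add_rdistrib)
  with assms show ?thesis by linarith
qed

lemma uminus_matrix_vector_mult: "(- A) *v x = - (A *v x)" for A :: "real^'n^'m"
  using matrix_vector_mult_diff_rdistrib[of 0 A x] by simp

lemma spnorm_uminus: "spnorm (- A) = spnorm A"
  by (simp add: spnorm_def uminus_matrix_vector_mult onorm_neg)

lemma spnorm_diff_le:
  assumes "spnorm A \<le> a" "spnorm B \<le> b"
  shows "spnorm (A - B) \<le> a + b"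
  using spnorm_add_le[of A a "- B" b] assms by (simp add: spnorm_uminus)

lemma spnorm_mult_le:
  assumes "spnorm A \<le> a" "spnorm B \<le> b"
  shows "spnorm (A ** B) \<le> a * b"
proof (rule spnorm_leI)
  fix x
  have "norm ((A ** B) *v x) \<le> spnorm A * norm (B *v x)"
    using norm_matrix_vector_le[of A "B *v x"] by (simp add: matrix_vector_mul_assoc)
  also have "\<dots> \<le> spnorm A * (spnorm B * norm x)"
    by (intro mult_left_mono norm_matrix_vector_le spnorm_nonneg)
  also have "\<dots> \<le> a * (b * norm x)"
    using assms spnorm_nonneg[of A] spnorm_nonneg[of B] by (intro mult_mono) auto
  finally show "norm ((A ** B) *v x) \<le> a * b * norm x" by (simp add: mult.assoc)
qed

lemma inner_transpose: "(transpose A *v x) \<bullet> y = x \<bullet> (A *v y)" for A :: "real^'n^'m"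
  by (simp add: dot_lmul_matrix)

lemma spnorm_transpose: "spnorm (transpose A) = spnorm A" for A :: "real^'n^'m"
proof -
  have le: "spnorm (transpose B) \<le> spnorm B" for B :: "real^'p^'q"
  proof (rule spnorm_leI)
    fix x
    let ?y = "transpose B *v x"
    have "norm ?y ^ 2 = x \<bullet> (B *v ?y)"
      using inner_transpose[of B x ?y] by (simp add: power2_norm_eq_inner)
    also have "\<dots> \<le> norm x * (spnorm B * norm ?y)"
      by (rule order_trans[OF norm_cauchy_schwarz]) (intro mult_left_mono norm_matrix_vector_le norm_ge_zero)
    finally have "norm ?y * norm ?y \<le> (spnorm B * norm x) * norm ?y"
      by (simp add: power2_eq_square mult_ac)
    then show "norm ?y \<le> spnorm B * norm x"
      by (cases "norm ?y = 0")
        (auto simp: spnorm_nonneg simp del: transpose_matrix_vector)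
  qed
  from le[of A] le[of "transpose A"] show ?thesis by simp
qed

lemma column_norm_le_spnorm: "norm (column j A) \<le> spnorm A" for A :: "real^'n^'m"
  using norm_matrix_vector_le[of A "axis j 1"] by (simp add: matrix_vector_mult_basis)

lemma row_norm_le_spnorm: "norm (row i A) \<le> spnorm A" for A :: "real^'n^'m"
  using column_norm_le_spnorm[of i "transpose A"] by (simp add: column_transpose spnorm_transpose)

lemma entry_le_spnorm: "\<bar>A $ i $ j\<bar> \<le> spnorm A" for A :: "real^'n^'m"
  using component_le_norm_cart[of "column j A" i] column_norm_le_spnorm[of j A]
  by (simp add: column_def)

lemma spnorm_le_entries:
  fixes A :: "real^'n^'m"
  assumes "\<And>i j. \<bar>A $ i $ j\<bar> \<le> b"
  shows "spnorm A \<le> real CARD('m) * real CARD('n) * b"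
  unfolding spnorm_def by (rule onorm_le_matrix_component) (rule assms)

section \<open>Rounding errors of sums and products\<close>

lemma compound_rounding:
  fixes \<epsilon> \<theta> \<delta> :: real
  assumes "\<bar>\<theta>\<bar> \<le> (2 ^ k - 1) * \<epsilon>" "\<bar>\<delta>\<bar> \<le> \<epsilon>" "\<epsilon> \<le> 1"
  shows "\<bar>\<theta> + \<delta> + \<theta> * \<delta>\<bar> \<le> (2 ^ Suc k - 1) * \<epsilon>"
proof -
  have "\<bar>\<theta> * \<delta>\<bar> \<le> \<bar>\<theta>\<bar> * 1"
    unfolding abs_mult using assms by (intro mult_left_mono) auto
  then show ?thesis using assms(1,2) by (simp add: algebra_simps)
qed

text \<open>Every term passes through at most \<open>card I - 1\<close> additions, whatever the bracketing. The rounding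
  is charged to the individual terms, because back-substitution needs it distributed over the
  entries of a row. The bound \<open>(2 ^ k - 1) * \<epsilon>\<close> replaces the usual \<open>(1 + \<epsilon>) ^ k - 1\<close>: for \<open>\<epsilon> \<le> 1\<close>
  it is still preserved by one more rounding, and it is linear in \<open>\<epsilon>\<close>.\<close>
lemma fl_sum_error:
  assumes "fl_sum \<epsilon> t I s" "0 \<le> \<epsilon>" "\<epsilon> \<le> 1"
  shows "finite I \<and> I \<noteq> {} \<and>
    (\<exists>\<theta>. s = (\<Sum>i\<in>I. t i * (1 + \<theta> i)) \<and> (\<forall>i\<in>I. \<bar>\<theta> i\<bar> \<le> (2 ^ card I - 1) * \<epsilon>))"
  using assms(1)
proof induction
  case (single i)
  show ?case using assms by (auto intro!: exI[of _ "\<lambda>_. 0"])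
next
  case (add I x J y s)
  from add.IH(1) obtain \<theta> where I: "finite I" "I \<noteq> {}" and x: "x = (\<Sum>i\<in>I. t i * (1 + \<theta> i))"
    and \<theta>: "\<And>i. i \<in> I \<Longrightarrow> \<bar>\<theta> i\<bar> \<le> (2 ^ card I - 1) * \<epsilon>" by blast
  from add.IH(2) obtain \<eta> where J: "finite J" "J \<noteq> {}" and y: "y = (\<Sum>i\<in>J. t i * (1 + \<eta> i))"
    and \<eta>: "\<And>i. i \<in> J \<Longrightarrow> \<bar>\<eta> i\<bar> \<le> (2 ^ card J - 1) * \<epsilon>" by blast
  from add.hyps obtain \<delta> where \<delta>: "\<bar>\<delta>\<bar> \<le> \<epsilon>" and s: "s = (x + y) * (1 + \<delta>)"
    by (auto simp: fl_def)
  define \<phi> where "\<phi> i = (if i \<in> I then \<theta> i else \<eta> i)" for i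
  define \<psi> where "\<psi> i = \<phi> i + \<delta> + \<phi> i * \<delta>" for i
  have card: "card (I \<union> J) = card I + card J"
    using I J add.hyps by (simp add: card_Un_disjoint)
  have pos: "0 < card I" "0 < card J" using I J by (auto simp: card_gt_0_iff)
  have xy: "x + y = (\<Sum>i\<in>I \<union> J. t i * (1 + \<phi> i))"
  proof -
    have "x = (\<Sum>i\<in>I. t i * (1 + \<phi> i))" unfolding x by (rule sum.cong) (auto simp: \<phi>_def)
    moreover have "y = (\<Sum>i\<in>J. t i * (1 + \<phi> i))"
      unfolding y using add.hyps by (intro sum.cong) (auto simp: \<phi>_def)
    ultimately show ?thesis using I J add.hyps by (simp add: sum.union_disjoint)
  qed
  have "s = (\<Sum>i\<in>I \<union> J. t i * (1 + \<psi> i))"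
    unfolding s xy sum_distrib_right by (intro sum.cong) (auto simp: \<psi>_def algebra_simps)
  moreover have "\<bar>\<psi> i\<bar> \<le> (2 ^ card (I \<union> J) - 1) * \<epsilon>" if "i \<in> I \<union> J" for i
  proof -
    obtain k where k: "Suc k \<le> card (I \<union> J)" "\<bar>\<phi> i\<bar> \<le> (2 ^ k - 1) * \<epsilon>"
    proof (cases "i \<in> I")
      case True
      then show ?thesis using that[of "card I"] \<theta>[of i] card pos by (simp add: \<phi>_def)
    next
      case False
      then show ?thesis using that[of "card J"] \<eta>[of i] card pos \<open>i \<in> I \<union> J\<close> by (simp add: \<phi>_def)
    qed
    have "\<bar>\<psi> i\<bar> \<le> (2 ^ Suc k - 1) * \<epsilon>"
      unfolding \<psi>_def by (rule compound_rounding[OF k(2) \<delta> assms(3)])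
    also have "\<dots> \<le> (2 ^ card (I \<union> J) - 1) * \<epsilon>"
      using power_increasing[OF k(1), of "2::real"] assms(2) by (intro mult_right_mono) auto
    finally show ?thesis .
  qed
  ultimately show ?case using I J by blast
qed

lemma fl_inner_error:
  fixes x y :: "real^'k"
  assumes "fl_inner \<epsilon> x y s" "0 \<le> \<epsilon>" "\<epsilon> \<le> 1"
  shows "\<bar>s - x \<bullet> y\<bar> \<le> 2 ^ Suc CARD('k) * \<epsilon> * (norm x * norm y)"
proof -
  obtain p where p: "\<And>i. fl \<epsilon> (x $ i * y $ i) (p i)" and s: "fl_sum \<epsilon> p UNIV s"
    using assms(1) by (auto simp: fl_inner_def)
  obtain \<theta> where s': "s = (\<Sum>i\<in>UNIV. p i * (1 + \<theta> i))"
    and \<theta>: "\<And>i. \<bar>\<theta> i\<bar> \<le> (2 ^ CARD('k) - 1) * \<epsilon>"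
    using fl_sum_error[OF s assms(2,3)] by auto
  obtain \<delta> where \<delta>: "\<And>i. \<bar>\<delta> i\<bar> \<le> \<epsilon>" and p': "\<And>i. p i = x $ i * y $ i * (1 + \<delta> i)"
    using p unfolding fl_def by metis
  define \<psi> where "\<psi> i = \<theta> i + \<delta> i + \<theta> i * \<delta> i" for i
  have \<psi>: "\<bar>\<psi> i\<bar> \<le> 2 ^ Suc CARD('k) * \<epsilon>" for i
    using compound_rounding[OF \<theta> \<delta> assms(3), of i i] assms(2) unfolding \<psi>_def
    by (simp add: left_diff_distrib)
  have "s - x \<bullet> y = (\<Sum>i\<in>UNIV. x $ i * y $ i * \<psi> i)"
    unfolding s' p' inner_vec_def sum_subtractf[symmetric]
    by (intro sum.cong) (auto simp: \<psi>_def algebra_simps)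
  also have "\<bar>\<dots>\<bar> \<le> (\<Sum>i\<in>UNIV. \<bar>x $ i\<bar> * \<bar>y $ i\<bar> * (2 ^ Suc CARD('k) * \<epsilon>))"
    by (rule order_trans[OF sum_abs], rule sum_mono)
      (auto simp: abs_mult intro!: mult_left_mono \<psi>[simplified])
  also have "\<dots> = 2 ^ Suc CARD('k) * \<epsilon> * (\<Sum>i\<in>UNIV. \<bar>x $ i\<bar> * \<bar>y $ i\<bar>)"
    by (simp add: sum_distrib_left mult_ac)
  also have "(\<Sum>i\<in>UNIV. \<bar>x $ i\<bar> * \<bar>y $ i\<bar>) \<le> norm x * norm y"
    unfolding norm_vec_def real_norm_def by (rule L2_set_mult_ineq[of "\<lambda>i. \<bar>x $ i\<bar>" "\<lambda>i. \<bar>y $ i\<bar>", simplified])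
  finally show ?thesis using assms(2) by (simp add: mult_left_mono)
qed

lemma fl_mat_mult_error:
  fixes X :: "real^'k^'m" and Y :: "real^'n^'k"
  assumes "fl_mat_mult \<epsilon> X Y Z" "0 \<le> \<epsilon>" "\<epsilon> \<le> 1"
  shows "spnorm (Z - X ** Y) \<le>
    real CARD('m) * real CARD('n) * (2 ^ Suc CARD('k) * \<epsilon> * (spnorm X * spnorm Y))"
proof (rule spnorm_le_entries)
  fix i j
  have "(X ** Y) $ i $ j = row i X \<bullet> column j Y"
    by (simp add: matrix_matrix_mult_def row_def column_def inner_vec_def)
  then have "\<bar>(Z - X ** Y) $ i $ j\<bar> \<le> 2 ^ Suc CARD('k) * \<epsilon> * (norm (row i X) * norm (column j Y))"
    using fl_inner_error[of \<epsilon> "row i X" "column j Y" "Z $ i $ j"] assms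
    by (simp add: fl_mat_mult_def)
  also have "\<dots> \<le> 2 ^ Suc CARD('k) * \<epsilon> * (spnorm X * spnorm Y)"
    using assms(2) by (intro mult_left_mono mult_mono row_norm_le_spnorm column_norm_le_spnorm)
      (auto simp: spnorm_nonneg)
  finally show "\<bar>(Z - X ** Y) $ i $ j\<bar> \<le> 2 ^ Suc CARD('k) * \<epsilon> * (spnorm X * spnorm Y)" .
qed

lemma fl_mat_vec_error:
  fixes X :: "real^'k^'m"
  assumes "fl_mat_vec \<epsilon> X y z" "0 \<le> \<epsilon>" "\<epsilon> \<le> 1"
  shows "norm (z - X *v y) \<le> real CARD('m) * (2 ^ Suc CARD('k) * \<epsilon> * (spnorm X * norm y))"
proof -
  have "\<bar>(z - X *v y) $ i\<bar> \<le> 2 ^ Suc CARD('k) * \<epsilon> * (spnorm X * norm y)" for i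
  proof -
    have "(X *v y) $ i = row i X \<bullet> y"
      by (simp add: matrix_vector_mult_def row_def inner_vec_def)
    then have "\<bar>(z - X *v y) $ i\<bar> \<le> 2 ^ Suc CARD('k) * \<epsilon> * (norm (row i X) * norm y)"
      using fl_inner_error[of \<epsilon> "row i X" y "z $ i"] assms by (simp add: fl_mat_vec_def)
    also have "\<dots> \<le> 2 ^ Suc CARD('k) * \<epsilon> * (spnorm X * norm y)"
      using assms(2) by (intro mult_left_mono mult_right_mono row_norm_le_spnorm) auto
    finally show ?thesis .
  qed
  then have "(\<Sum>i\<in>UNIV. \<bar>(z - X *v y) $ i\<bar>) \<le> (\<Sum>i\<in>(UNIV::'m set). 2 ^ Suc CARD('k) * \<epsilon> * (spnorm X * norm y))"
    by (intro sum_mono)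
  with norm_le_l1_cart[of "z - X *v y"] show ?thesis by simp
qed

lemma entrywise_rounding_error:
  fixes W Z :: "real^'n^'m"
  assumes "\<And>i j. fl \<epsilon> (W $ i $ j) (Z $ i $ j)" "0 \<le> \<epsilon>"
  shows "spnorm (Z - W) \<le> real CARD('m) * real CARD('n) * (\<epsilon> * spnorm W)"
proof (rule spnorm_le_entries)
  fix i j
  obtain \<delta> where "\<bar>\<delta>\<bar> \<le> \<epsilon>" "Z $ i $ j = W $ i $ j * (1 + \<delta>)"
    using assms(1)[of i j] by (auto simp: fl_def)
  then have "\<bar>(Z - W) $ i $ j\<bar> = \<bar>\<delta>\<bar> * \<bar>W $ i $ j\<bar>" by (simp add: algebra_simps abs_mult)
  also have "\<dots> \<le> \<epsilon> * spnorm W"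
    using \<open>\<bar>\<delta>\<bar> \<le> \<epsilon>\<close> assms(2) entry_le_spnorm[of W i j] by (intro mult_mono) auto
  finally show "\<bar>(Z - W) $ i $ j\<bar> \<le> \<epsilon> * spnorm W" .
qed

text \<open>Below the diagonal every product is zero, and relative rounding errors keep zeros exact.
  Back-substitution does not read these entries, so what it solves is a system with the full matrix
  only because they vanish.\<close>
lemma fl_mat_mult_upper_triangular:
  fixes X Y Z :: "real^('n::{finite,linorder})^('n::{finite,linorder})"
  assumes "fl_mat_mult \<epsilon> X Y Z" "0 \<le> \<epsilon>" "\<epsilon> \<le> 1" "upper_triangular X" "upper_triangular Y"
  shows "upper_triangular Z"
  unfolding upper_triangular_def
proof (intro allI impI)
  fix i j :: 'n assume ji: "j < i"
  obtain p where p: "\<And>k. fl \<epsilon> (X $ i $ k * Y $ k $ j) (p k)" and s: "fl_sum \<epsilon> p UNIV (Z $ i $ j)"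
    using assms(1)[unfolded fl_mat_mult_def fl_inner_def, rule_format, of i j]
    by (auto simp: row_def column_def)
  have "p k = 0" for k
  proof -
    have "k < i \<or> j < k" using ji by auto
    then have "X $ i $ k * Y $ k $ j = 0" using assms(4,5) by (auto simp: upper_triangular_def)
    then show ?thesis using p[of k] by (auto simp: fl_def)
  qed
  then show "Z $ i $ j = 0" using fl_sum_error[OF s assms(2,3)] by auto
qed

section \<open>Back-substitution\<close>

text \<open>A permutation that never moves an index down fixes every index, so each nonvanishing
  Leibniz term of the determinant contains every diagonal entry.\<close>
lemma upper_triangular_diag_nonzero:
  assumes "upper_triangular R" "invertible R"
  shows "R $ i $ i \<noteq> 0"
proof
  assume Rii: "R $ i $ i = 0"
  have "(\<Prod>k\<in>UNIV. R $ k $ p k) = 0" if p: "p permutes UNIV" for p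
  proof (rule ccontr)
    assume "(\<Prod>k\<in>UNIV. R $ k $ p k) \<noteq> 0"
    then have nz: "R $ k $ p k \<noteq> 0" for k by auto
    have up: "k \<le> p k" for k
      using nz[of k] assms(1) unfolding upper_triangular_def by (meson not_le)
    have inj: "inj p" using p by (rule permutes_inj)
    \<comment> \<open>The indices above \<open>i\<close> are permuted among themselves, which leaves only \<open>i\<close> for \<open>p i\<close>.\<close>
    have "p ` {i<..} \<subseteq> {i<..}" using up by (auto intro: less_le_trans)
    then have "p ` {i<..} = {i<..}"
      using inj by (intro endo_inj_surj) (auto intro: inj_on_subset)
    then have "p i \<notin> {i<..}" using inj by (metis inj_image_mem_iff greaterThan_iff less_irrefl)
    then have "p i = i" using up[of i] by auto
    then show False using nz[of i] Rii by simp
  qed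
  then have "det R = 0" unfolding det_def by (intro sum.neutral) auto
  then show False using assms(2) by (simp add: invertible_det_nz)
qed

text \<open>The rounding of the division is moved to the other side of the equation, where it perturbs
  the diagonal entry; the rounding of the numerator perturbs the remaining entries of the row and
  the right-hand side.\<close>
lemma fl_back_subst_error:
  fixes R :: "real^('l::{finite,linorder})^('l::{finite,linorder})"
  assumes "fl_back_subst \<epsilon> R g z" "0 \<le> \<epsilon>" "\<epsilon> \<le> 1/2" "upper_triangular R"
    and nz: "\<And>i. R $ i $ i \<noteq> 0"
  obtains \<Delta>R \<Delta>g where "(R + \<Delta>R) *v z = g + \<Delta>g"
    "spnorm \<Delta>R \<le> real CARD('l) * real CARD('l) * (2 ^ Suc CARD('l) * \<epsilon> * spnorm R)"
    "norm \<Delta>g \<le> real CARD('l) * (2 ^ Suc CARD('l) * \<epsilon> * norm g)"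
proof -
  let ?b = "2 ^ Suc CARD('l) * \<epsilon>"
  have e1: "\<epsilon> \<le> 1" using assms(3) by simp
  have "\<exists>r h. (\<Sum>j\<in>UNIV. (R $ i $ j + r j) * z $ j) = g $ i + h \<and>
      (\<forall>j. \<bar>r j\<bar> \<le> ?b * \<bar>R $ i $ j\<bar>) \<and> \<bar>h\<bar> \<le> ?b * \<bar>g $ i\<bar>" for i
  proof -
    obtain p s where p: "\<And>j. i < j \<Longrightarrow> fl \<epsilon> (R $ i $ j * z $ j) (p j)"
      and s: "fl_sum \<epsilon> (\<lambda>j. if j = i then g $ i else - p j) {i..} s"
      and d: "fl_div \<epsilon> s (R $ i $ i) (z $ i)"
      using assms(1) unfolding fl_back_subst_def by meson
    obtain \<theta> where s': "s = (\<Sum>j\<in>{i..}. (if j = i then g $ i else - p j) * (1 + \<theta> j))"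
      and \<theta>c: "\<And>j. j \<in> {i..} \<Longrightarrow> \<bar>\<theta> j\<bar> \<le> (2 ^ card {i..} - 1) * \<epsilon>"
      using fl_sum_error[OF s assms(2) e1] by blast
    have "(2::real) ^ card {i..} \<le> 2 ^ CARD('l)" by (intro power_increasing card_mono) auto
    then have \<theta>: "\<bar>\<theta> j\<bar> \<le> (2 ^ CARD('l) - 1) * \<epsilon>" if "i \<le> j" for j
      using \<theta>c[of j] that assms(2)
      by (meson atLeast_iff diff_right_mono mult_right_mono order_trans)
    have "\<forall>j\<in>{i<..}. \<exists>\<delta>. \<bar>\<delta>\<bar> \<le> \<epsilon> \<and> p j = R $ i $ j * z $ j * (1 + \<delta>)"
      using p by (auto simp: fl_def)
    then obtain \<delta> where \<delta>: "\<And>j. i < j \<Longrightarrow> \<bar>\<delta> j\<bar> \<le> \<epsilon>"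
      and p': "\<And>j. i < j \<Longrightarrow> p j = R $ i $ j * z $ j * (1 + \<delta> j)"
      unfolding bchoice_iff by auto
    obtain \<eta> where \<eta>: "\<bar>\<eta>\<bar> \<le> \<epsilon>" and z: "z $ i = s / R $ i $ i * (1 + \<eta>)"
      using d nz[of i] by (auto simp: fl_div_def fl_def)
    have \<eta>1: "1/2 \<le> 1 + \<eta>" using \<eta> assms(3) by linarith
    define \<psi> where "\<psi> j = \<theta> j + \<delta> j + \<theta> j * \<delta> j" for j
    have b0: "2 ^ CARD('l) * \<epsilon> \<le> ?b" "0 \<le> ?b" "(2 ^ CARD('l) - 1) * \<epsilon> \<le> ?b" "(2 ^ Suc CARD('l) - 1) * \<epsilon> \<le> ?b"
      using assms(2) order_trans[of "- 1" 0 "(2::real) ^ CARD('l)"] by (auto intro!: mult_right_mono)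
    have \<psi>: "\<bar>\<psi> j\<bar> \<le> ?b" if "i < j" for j
      unfolding \<psi>_def using that
      by (intro order_trans[OF compound_rounding[OF \<theta> \<delta> e1] b0(4)]) auto
    define \<rho> where "\<rho> = - \<eta> / (1 + \<eta>)"
    have \<rho>: "\<bar>\<rho>\<bar> \<le> ?b"
    proof -
      have "\<bar>\<rho>\<bar> \<le> \<epsilon> / (1/2)" unfolding \<rho>_def abs_divide
        using \<eta> \<eta>1 assms(2) by (intro frac_le) auto
      also have "\<dots> \<le> ?b"
        using mult_right_mono[OF power_increasing[of 1 "Suc CARD('l)" "2::real"] assms(2)]
        by (simp add: mult.commute)
      finally show ?thesis .
    qed
    define r where "r j = (if j = i then R $ i $ i * \<rho> else if i < j then R $ i $ j * \<psi> j else 0)" for j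
    have Rz: "R $ i $ i * (1 + \<rho>) * z $ i = s"
    proof -
      have "1 + \<rho> = 1 / (1 + \<eta>)" using \<eta>1 by (simp add: \<rho>_def field_simps)
      then show ?thesis using \<eta>1 nz[of i] by (simp add: z)
    qed
    have ins: "{i..} = insert i {i<..}" by auto
    have s'': "s = g $ i * (1 + \<theta> i) - (\<Sum>j\<in>{i<..}. R $ i $ j * z $ j * (1 + \<psi> j))"
    proof -
      have "s = g $ i * (1 + \<theta> i) + (\<Sum>j\<in>{i<..}. (if j = i then g $ i else - p j) * (1 + \<theta> j))"
        unfolding s' ins by (subst sum.insert) auto
      also have "(\<Sum>j\<in>{i<..}. (if j = i then g $ i else - p j) * (1 + \<theta> j))
          = (\<Sum>j\<in>{i<..}. - (R $ i $ j * z $ j * (1 + \<psi> j)))"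
        by (intro sum.cong) (auto simp: p' \<psi>_def algebra_simps)
      finally show ?thesis by (simp add: sum_negf)
    qed
    have "(\<Sum>j\<in>UNIV. (R $ i $ j + r j) * z $ j) = (\<Sum>j\<in>{i..}. (R $ i $ j + r j) * z $ j)"
      using assms(4) by (intro sum.mono_neutral_right) (auto simp: r_def upper_triangular_def)
    also have "\<dots> = R $ i $ i * (1 + \<rho>) * z $ i + (\<Sum>j\<in>{i<..}. (R $ i $ j + r j) * z $ j)"
      unfolding ins by (subst sum.insert) (auto simp: r_def algebra_simps)
    also have "(\<Sum>j\<in>{i<..}. (R $ i $ j + r j) * z $ j) = (\<Sum>j\<in>{i<..}. R $ i $ j * z $ j * (1 + \<psi> j))"
      by (intro sum.cong) (auto simp: r_def algebra_simps)
    finally have "(\<Sum>j\<in>UNIV. (R $ i $ j + r j) * z $ j) = g $ i + g $ i * \<theta> i"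
      unfolding Rz s'' by (simp add: algebra_simps)
    moreover have "\<bar>r j\<bar> \<le> ?b * \<bar>R $ i $ j\<bar>" for j
      using \<rho> \<psi>[of j] b0(2) mult_right_mono[of "\<bar>\<rho>\<bar>" ?b "\<bar>R $ i $ j\<bar>"]
        mult_right_mono[of "\<bar>\<psi> j\<bar>" ?b "\<bar>R $ i $ j\<bar>"]
      by (auto simp: r_def abs_mult mult.commute)
    moreover have "\<bar>g $ i * \<theta> i\<bar> \<le> ?b * \<bar>g $ i\<bar>"
      using order_trans[OF \<theta>[of i] b0(3)] mult_right_mono[of "\<bar>\<theta> i\<bar>" ?b "\<bar>g $ i\<bar>"]
      by (simp add: abs_mult mult.commute)
    ultimately show ?thesis by blast
  qed
  then have "\<forall>i. \<exists>r h. (\<Sum>j\<in>UNIV. (R $ i $ j + r j) * z $ j) = g $ i + h \<and>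
      (\<forall>j. \<bar>r j\<bar> \<le> ?b * \<bar>R $ i $ j\<bar>) \<and> \<bar>h\<bar> \<le> ?b * \<bar>g $ i\<bar>" ..
  from choice[OF this] obtain r where "\<forall>i. \<exists>h. (\<Sum>j\<in>UNIV. (R $ i $ j + r i j) * z $ j) = g $ i + h \<and>
      (\<forall>j. \<bar>r i j\<bar> \<le> ?b * \<bar>R $ i $ j\<bar>) \<and> \<bar>h\<bar> \<le> ?b * \<bar>g $ i\<bar>" ..
  from choice[OF this] obtain h where rh: "\<And>i. (\<Sum>j\<in>UNIV. (R $ i $ j + r i j) * z $ j) = g $ i + h i"
    and r: "\<And>i j. \<bar>r i j\<bar> \<le> ?b * \<bar>R $ i $ j\<bar>" and h: "\<And>i. \<bar>h i\<bar> \<le> ?b * \<bar>g $ i\<bar>"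
    by blast
  show ?thesis
  proof
    show "(R + (\<chi> i j. r i j)) *v z = g + (\<chi> i. h i)"
      by (simp add: vec_eq_iff matrix_vector_mult_def rh)
    show "spnorm (\<chi> i j. r i j) \<le> real CARD('l) * real CARD('l) * (?b * spnorm R)"
    proof (rule spnorm_le_entries)
      fix i j
      have "\<bar>r i j\<bar> \<le> ?b * spnorm R"
        by (rule order_trans[OF r]) (intro mult_left_mono entry_le_spnorm, use assms(2) in auto)
      then show "\<bar>(\<chi> i j. r i j) $ i $ j\<bar> \<le> ?b * spnorm R" by simp
    qed
    have "\<bar>h i\<bar> \<le> ?b * norm g" for i
      by (rule order_trans[OF h]) (intro mult_left_mono component_le_norm_cart, use assms(2) in auto)
    then have "(\<Sum>i\<in>UNIV. \<bar>h i\<bar>) \<le> (\<Sum>i\<in>(UNIV::'l set). ?b * norm g)" by (intro sum_mono)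
    with norm_le_l1_cart[of "\<chi> i. h i"]
    show "norm (\<chi> i. h i) \<le> real CARD('l) * (?b * norm g)" by simp
  qed
qed

section \<open>Projection and Q-R steps under perturbation\<close>

lemma nearly_orthonormal_bounds:
  fixes Q :: "real^'k^'l"
  assumes "spnorm (mat 1 - transpose Q ** Q) \<le> \<gamma>" "\<gamma> \<le> 3/4"
  shows "spnorm Q \<le> 2" "spnorm (transpose Q) \<le> 2" "norm x \<le> 2 * norm (Q *v x)"
proof -
  have sq: "\<bar>norm y ^ 2 - norm (Q *v y) ^ 2\<bar> \<le> 3/4 * norm y ^ 2" for y
  proof -
    have "y \<bullet> (transpose Q *v (Q *v y)) = norm (Q *v y) ^ 2"
      using inner_transpose[of Q "Q *v y" y] by (simp add: power2_norm_eq_inner inner_commute)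
    then have "norm y ^ 2 - norm (Q *v y) ^ 2 = y \<bullet> ((mat 1 - transpose Q ** Q) *v y)"
      by (simp add: matrix_vector_mult_diff_rdistrib matrix_vector_mul_assoc[symmetric]
        inner_diff_right power2_norm_eq_inner del: transpose_matrix_vector)
    also have "\<bar>\<dots>\<bar> \<le> norm y * (spnorm (mat 1 - transpose Q ** Q) * norm y)"
      by (rule order_trans[OF Cauchy_Schwarz_ineq2])
        (intro mult_left_mono norm_matrix_vector_le norm_ge_zero)
    also have "\<dots> \<le> norm y * (3/4 * norm y)"
      using order_trans[OF assms] by (intro mult_left_mono mult_right_mono norm_ge_zero)
    finally show ?thesis by (simp add: power2_eq_square mult_ac)
  qed
  have "norm (Q *v y) \<le> 2 * norm y" for y
  proof (rule power2_le_imp_le)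
    show "(norm (Q *v y))\<^sup>2 \<le> (2 * norm y)\<^sup>2"
      using sq[of y] zero_le_power2[of "norm y"] unfolding power_mult_distrib abs_le_iff by simp
  qed simp
  then show "spnorm Q \<le> 2" by (rule spnorm_leI)
  then show "spnorm (transpose Q) \<le> 2" by (simp add: spnorm_transpose)
  show "norm x \<le> 2 * norm (Q *v x)"
  proof (rule power2_le_imp_le)
    show "(norm x)\<^sup>2 \<le> (2 * norm (Q *v x))\<^sup>2"
      using sq[of x] unfolding power_mult_distrib abs_le_iff by simp
  qed simp
qed

text \<open>Lower bounds \<open>s * norm x \<le> norm (X *v x)\<close> stand in for the smallest singular value throughout:
  they survive perturbations by a mere triangle inequality, and they give both the full rank that
  the Q-R routine requires and bounds for inverses.\<close>
lemma full_rank_of_lower_bound: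
  fixes Y :: "real^'k^'l"
  assumes "s > 0" "\<And>x. s * norm x \<le> norm (Y *v x)"
  shows "rank Y = CARD('k)"
proof -
  have "x = y" if "Y *v x = Y *v y" for x y
  proof -
    have "s * norm (x - y) \<le> 0"
      using assms(2)[of "x - y"] that by (simp add: matrix_vector_mult_diff_distrib)
    then show ?thesis using assms(1) by (simp add: mult_le_0_iff)
  qed
  then show ?thesis by (simp add: full_rank_injective inj_def)
qed

lemma invertible_of_lower_bound:
  fixes R :: "real^'k^'k"
  assumes "s > 0" "\<And>x. s * norm x \<le> norm (R *v x)"
  shows "invertible R"
  using full_rank_of_lower_bound[OF assms]
  by (metis full_rank_injective invertible_left_inverse matrix_left_invertible_injective)

lemma preimage_of_lower_bound:
  fixes R :: "real^'k^'k"
  assumes "s > 0" "\<And>x. s * norm x \<le> norm (R *v x)"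
  obtains x where "R *v x = v" "norm x \<le> norm v / s"
proof -
  obtain x where x: "R *v x = v"
    using full_rank_of_lower_bound[OF assms] by (metis full_rank_surjective surjD)
  with assms(2)[of x] assms(1) have "norm x \<le> norm v / s" by (simp add: field_simps)
  with x show ?thesis by (rule that)
qed

text \<open>The computed projection \<open>S\<close> is itself used to form \<open>Y\<close>, so the large
  terms \<open>transpose Q ** X\<close> and \<open>S\<close> cancel in \<open>transpose Q ** Y\<close> and only rounding errors
  and the defect of orthonormality of \<open>Q\<close> remain.\<close>
lemma projection_step:
  fixes Q :: "real^'k^'l" and X P Y :: "real^'n^'l" and S :: "real^'n^'k"
  assumes Q: "spnorm (mat 1 - transpose Q ** Q) \<le> \<gamma>"
    and \<gamma>: "0 \<le> \<gamma>" "\<gamma> \<le> 1/100"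
    and X: "spnorm X \<le> \<nu>"
    and S: "spnorm (S - transpose Q ** X) \<le> \<gamma> * (spnorm (transpose Q) * spnorm X)"
    and P: "spnorm (P - Q ** S) \<le> \<gamma> * (spnorm Q * spnorm S)"
    and Y: "spnorm (Y - (X - P)) \<le> \<gamma> * spnorm (X - P)"
  shows "spnorm S \<le> 4 * \<nu>" "spnorm (Y - (X - Q ** S)) \<le> 18 * (\<gamma> * \<nu>)"
    "spnorm Y \<le> 10 * \<nu>" "spnorm (transpose Q ** Y) \<le> 42 * (\<gamma> * \<nu>)"
proof -
  have \<nu>: "0 \<le> \<nu>" using X spnorm_nonneg[of X] by linarith
  have a: "\<gamma> * \<nu> \<le> \<nu> / 100" using mult_right_mono[OF \<gamma>(2) \<nu>] by simp
  note q = nearly_orthonormal_bounds(1,2)[OF Q]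
  have q1: "spnorm Q \<le> 2" "spnorm (transpose Q) \<le> 2" using q \<gamma> by auto
  have "\<gamma> * (spnorm (transpose Q) * spnorm X) \<le> \<gamma> * (2 * \<nu>)"
    using q1 X \<gamma> by (intro mult_left_mono mult_mono) (auto simp: spnorm_nonneg)
  with S have S1: "spnorm (S - transpose Q ** X) \<le> 2 * (\<gamma> * \<nu>)" by simp
  from spnorm_add_le[OF this spnorm_mult_le[OF q1(2) X]] a \<nu>
  show S2: "spnorm S \<le> 4 * \<nu>" by simp
  have "\<gamma> * (spnorm Q * spnorm S) \<le> \<gamma> * (2 * (4 * \<nu>))"
    using q1 S2 \<gamma> by (intro mult_left_mono mult_mono) (auto simp: spnorm_nonneg)
  with P have P1: "spnorm (P - Q ** S) \<le> 8 * (\<gamma> * \<nu>)" by simp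
  from spnorm_add_le[OF this spnorm_mult_le[OF q1(1) S2]] a
  have P2: "spnorm P \<le> 9 * \<nu>" using \<nu> by simp
  from mult_left_mono[OF spnorm_diff_le[OF X P2] \<gamma>(1)] Y
  have Y1: "spnorm (Y - (X - P)) \<le> 10 * (\<gamma> * \<nu>)" by (simp add: algebra_simps)
  show G: "spnorm (Y - (X - Q ** S)) \<le> 18 * (\<gamma> * \<nu>)"
    using spnorm_diff_le[OF Y1 P1] by (simp add: algebra_simps)
  from spnorm_add_le[OF this spnorm_diff_le[OF X spnorm_mult_le[OF q1(1) S2]]] a
  show "spnorm Y \<le> 10 * \<nu>" using \<nu> by simp
  have eq: "transpose Q ** Y = (transpose Q ** (Y - (X - Q ** S)) - (S - transpose Q ** X))
      + (mat 1 - transpose Q ** Q) ** S"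
    by (simp add: matrix_eq algebra_simps matrix_vector_mul_assoc[symmetric]
        del: transpose_matrix_vector)
  show "spnorm (transpose Q ** Y) \<le> 42 * (\<gamma> * \<nu>)"
    unfolding eq
    using spnorm_add_le[OF spnorm_diff_le[OF spnorm_mult_le[OF q1(2) G] S1] spnorm_mult_le[OF Q S2]]
    by (simp add: algebra_simps)
qed

text \<open>The last bound, for \<open>Z = transpose Q\<^sub>1\<close> with an earlier block \<open>Q\<^sub>1\<close>, says what normalization does to
  orthogonality: since \<open>Q\<close> is about \<open>Y\<close> times the inverse of \<open>R\<close>, the defect of \<open>Y\<close> is divided by
  the smallest singular value \<open>s\<close> of \<open>Y\<close>. This loss is what makes a second pass necessary.\<close>
lemma qr_step:
  fixes Y Q :: "real^'k^'l" and R :: "real^'k^'k"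
  assumes s: "s > 0" "\<And>x. s * norm x \<le> norm (Y *v x)"
    and Y: "spnorm Y \<le> \<nu>"
    and Q: "spnorm (mat 1 - transpose Q ** Q) \<le> \<gamma>"
    and QR: "spnorm (Q ** R - Y) \<le> \<gamma> * spnorm Y"
    and \<gamma>: "0 \<le> \<gamma>" "\<gamma> \<le> 1/100" "\<gamma> * \<nu> \<le> s / 2"
  shows "spnorm (Q ** R - Y) \<le> \<gamma> * \<nu>" "spnorm R \<le> 4 * \<nu>"
    "\<And>x. s / 4 * norm x \<le> norm (R *v x)"
    "\<And>Z :: real^'l^'j. spnorm (Z ** Q) \<le> (spnorm (Z ** Y) + spnorm Z * (\<gamma> * \<nu>)) * (4 / s)"
proof -
  have \<nu>: "0 \<le> \<nu>" using Y spnorm_nonneg[of Y] by linarith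
  have a: "\<gamma> * \<nu> \<le> \<nu> / 100" using mult_right_mono[OF \<gamma>(2) \<nu>] by simp
  have q: "spnorm Q \<le> 2" "\<And>x. norm x \<le> 2 * norm (Q *v x)"
    using nearly_orthonormal_bounds[OF Q] \<gamma> by auto
  show E: "spnorm (Q ** R - Y) \<le> \<gamma> * \<nu>"
    using QR mult_left_mono[OF Y \<gamma>(1)] by linarith
  from spnorm_add_le[OF this Y] have QR: "spnorm (Q ** R) \<le> \<gamma> * \<nu> + \<nu>" by simp
  show "spnorm R \<le> 4 * \<nu>"
  proof (rule spnorm_leI)
    fix x
    have "norm (R *v x) \<le> 2 * norm ((Q ** R) *v x)"
      using q(2)[of "R *v x"] by (simp add: matrix_vector_mul_assoc)
    also have "\<dots> \<le> 2 * (spnorm (Q ** R) * norm x)"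
      using norm_matrix_vector_le by (intro mult_left_mono) auto
    also have "\<dots> \<le> 2 * ((2 * \<nu>) * norm x)"
      using QR a \<nu> by (intro mult_left_mono mult_right_mono) auto
    finally show "norm (R *v x) \<le> 4 * \<nu> * norm x" by simp
  qed
  show R: "s / 4 * norm x \<le> norm (R *v x)" for x
  proof -
    have "Y *v x = Q *v (R *v x) - (Q ** R - Y) *v x"
      by (simp add: algebra_simps matrix_vector_mul_assoc)
    then have "norm (Y *v x) \<le> norm (Q *v (R *v x)) + norm ((Q ** R - Y) *v x)"
      by (metis norm_triangle_ineq4)
    moreover have "norm (Q *v (R *v x)) \<le> 2 * norm (R *v x)"
      by (rule order_trans[OF norm_matrix_vector_le]) (use q in \<open>simp add: mult_right_mono\<close>)
    moreover have "norm ((Q ** R - Y) *v x) \<le> s / 2 * norm x"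
      by (rule order_trans[OF norm_matrix_vector_le]) (use E \<gamma>(3) in \<open>intro mult_right_mono; simp\<close>)
    ultimately show ?thesis using s(2)[of x] by linarith
  qed
  fix Z :: "real^'l^'j"
  show "spnorm (Z ** Q) \<le> (spnorm (Z ** Y) + spnorm Z * (\<gamma> * \<nu>)) * (4 / s)"
  proof (rule spnorm_leI)
    fix v
    obtain x where x: "R *v x = v" "norm x \<le> norm v / (s / 4)"
      using preimage_of_lower_bound[of "s / 4" R v] R s(1) by auto
    have eq: "(Z ** Q) *v v = (Z ** Y + Z ** (Q ** R - Y)) *v x"
      by (simp add: x(1)[symmetric] algebra_simps matrix_vector_mul_assoc[symmetric])
    have "norm ((Z ** Q) *v v) \<le> spnorm (Z ** Y + Z ** (Q ** R - Y)) * norm x"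
      unfolding eq by (rule norm_matrix_vector_le)
    also have "\<dots> \<le> (spnorm (Z ** Y) + spnorm Z * (\<gamma> * \<nu>)) * (norm v / (s / 4))"
      using spnorm_add_le[OF order_refl spnorm_mult_le[OF order_refl E], of "Z ** Y" Z] x(2) \<gamma>(1) \<nu>
      by (intro mult_mono) (auto simp: spnorm_nonneg)
    finally show "norm ((Z ** Q) *v v) \<le> (spnorm (Z ** Y) + spnorm Z * (\<gamma> * \<nu>)) * (4 / s) * norm v"
      using s(1) by (simp add: field_simps)
  qed
qed

section \<open>Block matrices acting on joined vectors\<close>

definition join_vec :: "real^'m \<Rightarrow> real^'n \<Rightarrow> real^('m + 'n)" where
  "join_vec x y = (\<chi> i. case i of Inl a \<Rightarrow> x $ a | Inr b \<Rightarrow> y $ b)"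

definition upper_part :: "real^('m::finite + 'n::finite) \<Rightarrow> real^'m" where
  "upper_part w = (\<chi> a. w $ Inl a)"

definition lower_part :: "real^('m::finite + 'n::finite) \<Rightarrow> real^'n" where
  "lower_part w = (\<chi> b. w $ Inr b)"

lemma parts_join_vec [simp]: "upper_part (join_vec x y) = x" "lower_part (join_vec x y) = y"
  by (simp_all add: join_vec_def upper_part_def lower_part_def vec_eq_iff)

lemma join_vec_parts [simp]: "join_vec (upper_part w) (lower_part w) = w"
  by (simp add: join_vec_def upper_part_def lower_part_def vec_eq_iff split: sum.split)

lemma join_vec_diff: "join_vec x y - join_vec x' y' = join_vec (x - x') (y - y')"
  by (simp add: join_vec_def vec_eq_iff split: sum.split)

lemma sum_UNIV_sum: "(\<Sum>i\<in>UNIV. g i) = (\<Sum>a\<in>UNIV. g (Inl a)) + (\<Sum>b\<in>UNIV. g (Inr b))"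
  for g :: "'m::finite + 'n::finite \<Rightarrow> real"
  unfolding UNIV_Plus_UNIV[symmetric] by (simp add: sum.Plus del: UNIV_Plus_UNIV)

lemma inner_parts: "w \<bullet> v = upper_part w \<bullet> upper_part v + lower_part w \<bullet> lower_part v"
  by (simp add: inner_vec_def sum_UNIV_sum upper_part_def lower_part_def)

lemma norm_parts_squared: "norm w ^ 2 = norm (upper_part w) ^ 2 + norm (lower_part w) ^ 2"
  by (simp add: power2_norm_eq_inner inner_parts)

lemma norm_upper_part_le: "norm (upper_part w) \<le> norm w"
  by (rule power2_le_imp_le) (simp_all add: norm_parts_squared[of w])

lemma norm_lower_part_le: "norm (lower_part w) \<le> norm w"
  by (rule power2_le_imp_le) (simp_all add: norm_parts_squared[of w])

lemma norm_join_vec_le: "norm (join_vec x y) \<le> norm x + norm y"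
  by (rule power2_le_imp_le) (simp_all add: norm_parts_squared[of "join_vec x y"] power2_sum)

lemma hcat_mult_vec: "hcat X Y *v w = X *v upper_part w + Y *v lower_part w"
  by (simp add: vec_eq_iff matrix_vector_mult_def hcat_def sum_UNIV_sum upper_part_def lower_part_def)

lemma vcat_mult_vec: "vcat X Y *v x = join_vec (X *v x) (Y *v x)"
  by (simp add: vec_eq_iff matrix_vector_mult_def vcat_def join_vec_def split: sum.split)

lemma join_vec_add: "join_vec x y + join_vec x' y' = join_vec (x + x') (y + y')"
  by (simp add: join_vec_def vec_eq_iff split: sum.split)

lemma block_mat_mult_vec:
  "block_mat A B C D *v w = join_vec (A *v upper_part w + B *v lower_part w)
    (C *v upper_part w + D *v lower_part w)"
  by (simp add: block_mat_def hcat_mult_vec vcat_mult_vec join_vec_add)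

lemma transpose_hcat: "transpose (hcat X Y) = vcat (transpose X) (transpose Y)"
  by (simp add: vec_eq_iff transpose_def hcat_def vcat_def split: sum.split)

lemma spnorm_hcat_le:
  fixes X :: "real^'m^'l" and Y :: "real^'n^'l"
  assumes "spnorm X \<le> a" "spnorm Y \<le> b"
  shows "spnorm (hcat X Y) \<le> a + b"
proof (rule spnorm_leI)
  fix w :: "real^('m + 'n)"
  have "norm (X *v upper_part w) \<le> a * norm w"
    using assms by (intro order_trans[OF norm_matrix_vector_le] mult_mono norm_upper_part_le)
      (auto intro: order_trans[OF spnorm_nonneg])
  moreover have "norm (Y *v lower_part w) \<le> b * norm w"
    using assms by (intro order_trans[OF norm_matrix_vector_le] mult_mono norm_lower_part_le)
      (auto intro: order_trans[OF spnorm_nonneg])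
  ultimately show "norm (hcat X Y *v w) \<le> (a + b) * norm w"
    unfolding hcat_mult_vec distrib_right by (rule norm_triangle_mono)
qed

lemma spnorm_vcat_le:
  assumes "spnorm X \<le> a" "spnorm Y \<le> b"
  shows "spnorm (vcat X Y) \<le> a + b"
proof (rule spnorm_leI)
  fix x
  have "norm (X *v x) \<le> a * norm x" "norm (Y *v x) \<le> b * norm x"
    using assms by (auto intro!: order_trans[OF norm_matrix_vector_le] mult_right_mono)
  then show "norm (vcat X Y *v x) \<le> (a + b) * norm x"
    using norm_join_vec_le[of "X *v x" "Y *v x"] by (simp add: vcat_mult_vec distrib_right)
qed

text \<open>Lower bounds for the joined matrix control each half of the argument separately; this lets the
  analysis of the factorization work with the two block columns alone.\<close>
lemma block_bounds:
  fixes M\<^sub>1 :: "real^'m^'l" and M\<^sub>2 :: "real^'n^'l"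
  assumes "\<And>w. \<sigma> * norm w \<le> norm (hcat M\<^sub>1 M\<^sub>2 *v w)" "0 \<le> \<sigma>"
  shows "\<sigma> * norm x \<le> norm (M\<^sub>1 *v x + M\<^sub>2 *v y)" "\<sigma> * norm y \<le> norm (M\<^sub>1 *v x + M\<^sub>2 *v y)"
    and "spnorm M\<^sub>1 \<le> spnorm (hcat M\<^sub>1 M\<^sub>2)" "spnorm M\<^sub>2 \<le> spnorm (hcat M\<^sub>1 M\<^sub>2)"
proof -
  have w: "\<sigma> * norm (join_vec x y) \<le> norm (M\<^sub>1 *v x + M\<^sub>2 *v y)"
    using assms(1)[of "join_vec x y"] by (simp add: hcat_mult_vec)
  show "\<sigma> * norm x \<le> norm (M\<^sub>1 *v x + M\<^sub>2 *v y)"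
    using norm_upper_part_le[of "join_vec x y"] assms(2)
    by (intro order_trans[OF _ w] mult_left_mono) auto
  show "\<sigma> * norm y \<le> norm (M\<^sub>1 *v x + M\<^sub>2 *v y)"
    using norm_lower_part_le[of "join_vec x y"] assms(2)
    by (intro order_trans[OF _ w] mult_left_mono) auto
  show "spnorm M\<^sub>1 \<le> spnorm (hcat M\<^sub>1 M\<^sub>2)"
  proof (rule spnorm_leI)
    fix x
    have "norm (M\<^sub>1 *v x) = norm (hcat M\<^sub>1 M\<^sub>2 *v join_vec x 0)" by (simp add: hcat_mult_vec)
    also have "\<dots> \<le> spnorm (hcat M\<^sub>1 M\<^sub>2) * norm (join_vec x (0::real^'n))"
      by (rule norm_matrix_vector_le)
    also have "\<dots> \<le> spnorm (hcat M\<^sub>1 M\<^sub>2) * norm x"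
      using norm_join_vec_le[of x "0::real^'n"] by (simp add: mult_left_mono spnorm_nonneg)
    finally show "norm (M\<^sub>1 *v x) \<le> spnorm (hcat M\<^sub>1 M\<^sub>2) * norm x" .
  qed
  show "spnorm M\<^sub>2 \<le> spnorm (hcat M\<^sub>1 M\<^sub>2)"
  proof (rule spnorm_leI)
    fix y
    have "norm (M\<^sub>2 *v y) = norm (hcat M\<^sub>1 M\<^sub>2 *v join_vec 0 y)" by (simp add: hcat_mult_vec)
    also have "\<dots> \<le> spnorm (hcat M\<^sub>1 M\<^sub>2) * norm (join_vec (0::real^'m) y)"
      by (rule norm_matrix_vector_le)
    also have "\<dots> \<le> spnorm (hcat M\<^sub>1 M\<^sub>2) * norm y"
      using norm_join_vec_le[of "0::real^'m" y] by (simp add: mult_left_mono spnorm_nonneg)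
    finally show "norm (M\<^sub>2 *v y) \<le> spnorm (hcat M\<^sub>1 M\<^sub>2) * norm y" .
  qed
qed

lemma hcat_nearly_orthonormal:
  assumes X: "spnorm (mat 1 - transpose X ** X) \<le> a" and Y: "spnorm (mat 1 - transpose Y ** Y) \<le> b"
    and XY: "spnorm (transpose X ** Y) \<le> d"
  shows "spnorm (mat 1 - transpose (hcat X Y) ** hcat X Y) \<le> a + b + 2 * d"
proof -
  have YX: "spnorm (- (transpose Y ** X)) \<le> d" "spnorm (- (transpose X ** Y)) \<le> d"
    using XY spnorm_transpose[of "transpose X ** Y"] by (simp_all add: matrix_transpose_mul spnorm_uminus)
  have "(mat 1 - transpose (hcat X Y) ** hcat X Y) *v w
      = hcat (vcat (mat 1 - transpose X ** X) (- (transpose Y ** X)))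
          (vcat (- (transpose X ** Y)) (mat 1 - transpose Y ** Y)) *v w" for w
  proof -
    have "w = join_vec (upper_part w) (lower_part w)" by simp
    then have "(mat 1 - transpose (hcat X Y) ** hcat X Y) *v w
      = join_vec (upper_part w) (lower_part w) - transpose (hcat X Y) *v (hcat X Y *v w)"
      by (simp add: matrix_vector_mult_diff_rdistrib matrix_vector_mul_assoc[symmetric]
        del: transpose_matrix_vector)
    then show ?thesis
      by (simp add: transpose_hcat hcat_mult_vec vcat_mult_vec join_vec_add join_vec_diff uminus_matrix_vector_mult
        algebra_simps matrix_vector_mul_assoc[symmetric] del: transpose_matrix_vector join_vec_parts)
  qed
  then have eq: "mat 1 - transpose (hcat X Y) ** hcat X Y
      = hcat (vcat (mat 1 - transpose X ** X) (- (transpose Y ** X)))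
          (vcat (- (transpose X ** Y)) (mat 1 - transpose Y ** Y))"
    by (simp add: matrix_eq)
  show ?thesis
    unfolding eq using spnorm_hcat_le[OF spnorm_vcat_le[OF X YX(1)] spnorm_vcat_le[OF YX(2) Y]]
    by simp
qed

lemma upper_triangular_block_mat:
  assumes "upper_triangular R\<^sub>1" "upper_triangular R\<^sub>2"
  shows "upper_triangular (block_mat R\<^sub>1 S 0 R\<^sub>2)"
  using assms unfolding upper_triangular_def block_mat_def hcat_def vcat_def
  by (auto simp: less_sum_def less_eq_sum_def less_le_not_le split: sum.splits)

lemma hcat_mult_block_mat:
  "hcat Q\<^sub>1 Q\<^sub>2 ** block_mat R\<^sub>1 S 0 R\<^sub>2 = hcat (Q\<^sub>1 ** R\<^sub>1) (Q\<^sub>1 ** S + Q\<^sub>2 ** R\<^sub>2)"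
  by (simp add: matrix_eq matrix_vector_mul_assoc[symmetric] hcat_mult_vec block_mat_mult_vec algebra_simps)

lemma hcat_diff: "hcat X Y - hcat X' Y' = hcat (X - X') (Y - Y')"
  by (simp add: hcat_def vec_eq_iff split: sum.split)

section \<open>Rounding errors of BCGS2 and of the solution method\<close>

text \<open>A crude constant, monotone in \<open>l\<close>, that covers every basic matrix operation with dimensions at
  most \<open>l\<close>.\<close>
definition rounding_factor :: "nat \<Rightarrow> real" where
  "rounding_factor l = real l * real l * 2 ^ Suc l"

lemma rounding_factor_ge:
  assumes "a \<le> l" "b \<le> l" "c \<le> l"
  shows "real a * real b * 2 ^ Suc c \<le> rounding_factor l"
  unfolding rounding_factor_def using assms
  by (intro mult_mono power_increasing) auto

text \<open>All error bounds are expressed through one unit \<open>\<gamma>\<close>, so that the remaining constants are plain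
  numbers. It will be \<open>\<epsilon>\<close> times a constant that depends on the dimensions only, the constants of the
  Q-R routine being absorbed in it.\<close>
context
  fixes \<epsilon> \<gamma> :: real and l :: nat
  assumes \<epsilon>: "0 \<le> \<epsilon>" "\<epsilon> \<le> 1" and unit: "\<epsilon> * rounding_factor l \<le> \<gamma>"
begin

lemma rounding_factor_scaled:
  assumes "a \<le> l" "b \<le> l" "c \<le> l" "0 \<le> N"
  shows "real a * real b * (2 ^ Suc c * \<epsilon> * N) \<le> \<gamma> * N"
proof -
  have "real a * real b * (2 ^ Suc c * \<epsilon> * N) = \<epsilon> * (real a * real b * 2 ^ Suc c) * N"
    by (simp add: mult_ac)
  also have "\<dots> \<le> \<epsilon> * rounding_factor l * N"
    using rounding_factor_ge[OF assms(1-3)] \<epsilon> assms(4) by (intro mult_right_mono mult_left_mono)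
  also have "\<dots> \<le> \<gamma> * N" using unit assms(4) by (rule mult_right_mono)
  finally show ?thesis .
qed

lemma fl_mat_mult_unit_error:
  fixes X :: "real^'k^'m" and Y :: "real^'n^'k"
  assumes "fl_mat_mult \<epsilon> X Y Z" "CARD('m) \<le> l" "CARD('n) \<le> l" "CARD('k) \<le> l"
  shows "spnorm (Z - X ** Y) \<le> \<gamma> * (spnorm X * spnorm Y)"
  using order_trans[OF fl_mat_mult_error[OF assms(1) \<epsilon>] rounding_factor_scaled[OF assms(2-4)]]
  by (simp add: spnorm_nonneg)

lemma fl_mat_vec_unit_error:
  fixes X :: "real^'k^'m"
  assumes "fl_mat_vec \<epsilon> X y z" "CARD('m) \<le> l" "CARD('k) \<le> l"
  shows "norm (z - X *v y) \<le> \<gamma> * (spnorm X * norm y)"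
proof -
  have "1 \<le> l" using assms(2) by (metis One_nat_def Suc_leI dual_order.trans zero_less_card_finite)
  from rounding_factor_scaled[OF assms(2) this assms(3), of "spnorm X * norm y"]
  show ?thesis using fl_mat_vec_error[OF assms(1) \<epsilon>] by (simp add: spnorm_nonneg)
qed

lemma entrywise_unit_error:
  fixes W Z :: "real^'n^'m"
  assumes "\<And>i j. fl \<epsilon> (W $ i $ j) (Z $ i $ j)" "CARD('m) \<le> l" "CARD('n) \<le> l"
  shows "spnorm (Z - W) \<le> \<gamma> * spnorm W"
proof -
  have "real CARD('m) * real CARD('n) * (\<epsilon> * spnorm W)
      \<le> real CARD('m) * real CARD('n) * (2 ^ Suc 0 * \<epsilon> * spnorm W)"
    using \<epsilon> by (intro mult_left_mono mult_right_mono) (auto simp: spnorm_nonneg)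
  also have "\<dots> \<le> \<gamma> * spnorm W"
    using assms(2,3) by (intro rounding_factor_scaled spnorm_nonneg) auto
  finally show ?thesis using entrywise_rounding_error[OF assms(1) \<epsilon>(1)] by linarith
qed

lemma fl_mat_diff_unit_error:
  fixes X Y Z :: "real^'n^'m"
  assumes "fl_mat_diff \<epsilon> X Y Z" "CARD('m) \<le> l" "CARD('n) \<le> l"
  shows "spnorm (Z - (X - Y)) \<le> \<gamma> * spnorm (X - Y)"
  using assms by (intro entrywise_unit_error) (auto simp: fl_mat_diff_def)

lemma fl_mat_add_unit_error:
  fixes X Y Z :: "real^'n^'m"
  assumes "fl_mat_add \<epsilon> X Y Z" "CARD('m) \<le> l" "CARD('n) \<le> l"
  shows "spnorm (Z - (X + Y)) \<le> \<gamma> * spnorm (X + Y)"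
  using assms by (intro entrywise_unit_error) (auto simp: fl_mat_add_def)

lemma fl_thin_qr_unit_error:
  fixes X :: "real^('k::{finite,linorder})^'l"
  assumes "fl_thin_qr \<epsilon> L X Q R" "rank X = CARD('k)" "\<epsilon> * L CARD('l) CARD('k) \<le> \<gamma>"
  shows "upper_triangular R" "spnorm (mat 1 - transpose Q ** Q) \<le> \<gamma>"
    "spnorm (Q ** R - X) \<le> \<gamma> * spnorm X"
proof -
  from assms(1,2) obtain \<Delta>X where *: "upper_triangular R"
    "spnorm (mat 1 - transpose Q ** Q) \<le> \<epsilon> * L CARD('l) CARD('k)"
    "X + \<Delta>X = Q ** R" "spnorm \<Delta>X \<le> \<epsilon> * L CARD('l) CARD('k) * spnorm X"
    by (auto simp: fl_thin_qr_def)
  show "upper_triangular R" by fact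
  show "spnorm (mat 1 - transpose Q ** Q) \<le> \<gamma>" using *(2) assms(3) by linarith
  have "spnorm (Q ** R - X) = spnorm \<Delta>X" unfolding *(3)[symmetric] by simp
  also have "\<dots> \<le> \<gamma> * spnorm X"
    using *(4) mult_right_mono[OF assms(3) spnorm_nonneg[of X]] by linarith
  finally show "spnorm (Q ** R - X) \<le> \<gamma> * spnorm X" .
qed

text \<open>The first pass leaves \<open>transpose Q\<^sub>1 ** Q\<^sub>2\<close> of order \<open>\<gamma> * \<mu> / \<sigma>\<close>, a multiple of \<open>\<epsilon>\<close> times the
  condition number: not negligible, but at most \<open>1/100\<close>. Hence \<open>Q\<^sub>2\<close> loses little when it is projected again,
  \<open>Y\<^sub>2\<close> has its singular values bounded below by \<open>1/4\<close>, and the second normalization costs only a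
  numerical factor. The residual is harmless for a different reason: no inverse enters it, and the
  errors of the individual steps just add up.\<close>
lemma fl_bcgs2_error:
  fixes M\<^sub>1 :: "real^('m::{finite,linorder})^'l" and M\<^sub>2 :: "real^('n::{finite,linorder})^'l"
  assumes fl: "fl_bcgs2 \<epsilon> L M\<^sub>1 M\<^sub>2 Q R"
    and dims: "CARD('l) = l" "CARD('m) \<le> l" "CARD('n) \<le> l"
    and L: "\<epsilon> * L CARD('l) CARD('m) \<le> \<gamma>" "\<epsilon> * L CARD('l) CARD('n) \<le> \<gamma>"
    and \<gamma>: "0 \<le> \<gamma>" "\<gamma> \<le> 1 / 10^5"
    and \<sigma>: "0 < \<sigma>" "\<And>w. \<sigma> * norm w \<le> norm (hcat M\<^sub>1 M\<^sub>2 *v w)"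
    and \<mu>: "spnorm (hcat M\<^sub>1 M\<^sub>2) \<le> \<mu>"
    and small: "\<gamma> * \<mu> \<le> \<sigma> / 10^5"
  shows "upper_triangular R"
    and "spnorm (mat 1 - transpose Q ** Q) \<le> 4000 * \<gamma>"
    and "spnorm (Q ** R - hcat M\<^sub>1 M\<^sub>2) \<le> 10000 * (\<gamma> * \<mu>)"
proof -
  obtain Q\<^sub>1 R\<^sub>1 S\<^sub>1 P\<^sub>1 Y\<^sub>1 Q\<^sub>2 R\<^sub>2 S\<^sub>2 P\<^sub>2 Y\<^sub>2 Q\<^sub>2' R\<^sub>2b P\<^sub>3 S' R\<^sub>2' where
      qr1: "fl_thin_qr \<epsilon> L M\<^sub>1 Q\<^sub>1 R\<^sub>1"
    and S\<^sub>1: "fl_mat_mult \<epsilon> (transpose Q\<^sub>1) M\<^sub>2 S\<^sub>1"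
    and P\<^sub>1: "fl_mat_mult \<epsilon> Q\<^sub>1 S\<^sub>1 P\<^sub>1" and Y\<^sub>1: "fl_mat_diff \<epsilon> M\<^sub>2 P\<^sub>1 Y\<^sub>1"
    and qr2: "fl_thin_qr \<epsilon> L Y\<^sub>1 Q\<^sub>2 R\<^sub>2"
    and S\<^sub>2: "fl_mat_mult \<epsilon> (transpose Q\<^sub>1) Q\<^sub>2 S\<^sub>2"
    and P\<^sub>2: "fl_mat_mult \<epsilon> Q\<^sub>1 S\<^sub>2 P\<^sub>2" and Y\<^sub>2: "fl_mat_diff \<epsilon> Q\<^sub>2 P\<^sub>2 Y\<^sub>2"
    and qr3: "fl_thin_qr \<epsilon> L Y\<^sub>2 Q\<^sub>2' R\<^sub>2b"
    and P\<^sub>3: "fl_mat_mult \<epsilon> S\<^sub>2 R\<^sub>2 P\<^sub>3" and S': "fl_mat_add \<epsilon> S\<^sub>1 P\<^sub>3 S'"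
    and R\<^sub>2': "fl_mat_mult \<epsilon> R\<^sub>2b R\<^sub>2 R\<^sub>2'"
    and Q: "Q = hcat Q\<^sub>1 Q\<^sub>2'" and R: "R = block_mat R\<^sub>1 S' 0 R\<^sub>2'"
    using fl unfolding fl_bcgs2_def by blast
  define a where "a = \<gamma> * \<mu>"
  have \<gamma>1: "\<gamma> \<le> 1/100" using \<gamma>(2) by simp
  have \<mu>0: "0 \<le> \<mu>" using \<mu> spnorm_nonneg[of "hcat M\<^sub>1 M\<^sub>2"] by linarith
  have a0: "0 \<le> a" and a\<sigma>: "a \<le> \<sigma> / 100000" and a\<mu>: "a \<le> \<mu> / 100000"
    using \<gamma> \<mu>0 small mult_right_mono[OF \<gamma>(2) \<mu>0] by (auto simp: a_def)
  note block = block_bounds[OF \<sigma>(2) less_imp_le[OF \<sigma>(1)]]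
  have M1: "spnorm M\<^sub>1 \<le> \<mu>" and M2: "spnorm M\<^sub>2 \<le> \<mu>" using block(3,4) \<mu> by auto
  have lM1: "\<sigma> * norm x \<le> norm (M\<^sub>1 *v x)" for x using block(1)[of x 0] by simp

  note qr1 = fl_thin_qr_unit_error[OF qr1 full_rank_of_lower_bound[OF \<sigma>(1) lM1] L(1)]
  have "\<gamma> * \<mu> \<le> \<sigma> / 2" using a\<sigma> \<sigma>(1) by (simp add: a_def)
  note step1 = qr_step[OF \<sigma>(1) lM1 M1 qr1(2,3) \<gamma>(1) \<gamma>1 this, folded a_def]
  have q1: "spnorm Q\<^sub>1 \<le> 2" "spnorm (transpose Q\<^sub>1) \<le> 2"
    using nearly_orthonormal_bounds(1,2)[OF qr1(2)] \<gamma>1 by auto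

  note proj1 = projection_step[OF qr1(2) \<gamma>(1) \<gamma>1 M2
      fl_mat_mult_unit_error[OF S\<^sub>1] fl_mat_mult_unit_error[OF P\<^sub>1] fl_mat_diff_unit_error[OF Y\<^sub>1],
      unfolded dims(1), OF dims(2,3) order_refl order_refl dims(3) dims(2) order_refl dims(3),
      folded a_def]
  \<comment> \<open>The exact \<open>Y\<^sub>1 *v y\<close> is \<open>M\<^sub>1 *v x + M\<^sub>2 *v y\<close> for the \<open>x\<close> below. That \<open>x\<close> may be larger than \<open>y\<close> by a
    factor of the condition number, so the error \<open>a * norm x\<close> must not be compared with \<open>norm y\<close>;
    it is absorbed by \<open>N\<close>, which dominates \<open>\<sigma> * norm x\<close>.\<close>
  have lY1: "\<sigma> / 2 * norm y \<le> norm (Y\<^sub>1 *v y)" for y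
  proof -
    obtain x where x: "R\<^sub>1 *v x = - (S\<^sub>1 *v y)"
      using preimage_of_lower_bound[OF _ step1(3)] \<sigma>(1) by auto
    define N where "N = norm (M\<^sub>1 *v x + M\<^sub>2 *v y)"
    have N: "\<sigma> * norm x \<le> N" "\<sigma> * norm y \<le> N" "0 \<le> N"
      using block(1,2) by (auto simp: N_def)
    have "Q\<^sub>1 *v (R\<^sub>1 *v x) = - (Q\<^sub>1 *v (S\<^sub>1 *v y))"
      unfolding x using matrix_vector_mult_diff_distrib[of Q\<^sub>1 0 "S\<^sub>1 *v y"] by simp
    then have "M\<^sub>1 *v x + M\<^sub>2 *v y = Y\<^sub>1 *v y - (Q\<^sub>1 ** R\<^sub>1 - M\<^sub>1) *v x - (Y\<^sub>1 - (M\<^sub>2 - Q\<^sub>1 ** S\<^sub>1)) *v y"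
      by (simp add: algebra_simps matrix_vector_mul_assoc[symmetric])
    then have "N \<le> norm (Y\<^sub>1 *v y) + norm ((Q\<^sub>1 ** R\<^sub>1 - M\<^sub>1) *v x) + norm ((Y\<^sub>1 - (M\<^sub>2 - Q\<^sub>1 ** S\<^sub>1)) *v y)"
      unfolding N_def by (metis (no_types, lifting) norm_triangle_le_diff norm_triangle_ineq4 add_right_mono order_trans)
    moreover have "norm ((Q\<^sub>1 ** R\<^sub>1 - M\<^sub>1) *v x) \<le> \<sigma> / 100000 * norm x"
      using step1(1) a\<sigma> by (intro order_trans[OF norm_matrix_vector_le] mult_right_mono) auto
    moreover have "norm ((Y\<^sub>1 - (M\<^sub>2 - Q\<^sub>1 ** S\<^sub>1)) *v y) \<le> 18 * (\<sigma> / 100000) * norm y"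
      using proj1(2) a\<sigma> by (intro order_trans[OF norm_matrix_vector_le] mult_right_mono) auto
    ultimately show ?thesis using N by (simp add: algebra_simps)
  qed

  have s2: "0 < \<sigma> / 2" using \<sigma>(1) by simp
  have "\<gamma> * (10 * \<mu>) = 10 * a" by (simp add: a_def)
  note qr2 = fl_thin_qr_unit_error[OF qr2 full_rank_of_lower_bound[OF s2 lY1] L(2)]
  have "\<gamma> * (10 * \<mu>) \<le> \<sigma> / 2 / 2" using a\<sigma> \<sigma>(1) by (simp add: a_def)
  note step2 = qr_step[OF s2 lY1 proj1(3) qr2(2,3) \<gamma>(1) \<gamma>1 this, unfolded \<open>\<gamma> * (10 * \<mu>) = 10 * a\<close>]
  have q2: "spnorm Q\<^sub>2 \<le> 2" "\<And>x. norm x \<le> 2 * norm (Q\<^sub>2 *v x)"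
    using nearly_orthonormal_bounds(1,3)[OF qr2(2)] \<gamma>1 by auto
  \<comment> \<open>This estimate decides the smallness assumption: \<open>10^5\<close> leaves \<open>496 / 10^5\<close> here.\<close>
  have q12: "spnorm (transpose Q\<^sub>1 ** Q\<^sub>2) \<le> 1/100"
  proof -
    have "spnorm (transpose Q\<^sub>1) * (10 * a) \<le> 2 * (10 * a)"
      using q1(2) a0 by (intro mult_right_mono) auto
    then have "spnorm (transpose Q\<^sub>1 ** Y\<^sub>1) + spnorm (transpose Q\<^sub>1) * (10 * a) \<le> 62 * (\<sigma> / 100000)"
      using proj1(4) a\<sigma> by linarith
    then have "spnorm (transpose Q\<^sub>1 ** Q\<^sub>2) \<le> 62 * (\<sigma> / 100000) * (4 / (\<sigma> / 2))"
      using \<sigma>(1) by (intro order_trans[OF step2(4)[of "transpose Q\<^sub>1"]] mult_right_mono) auto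
    also have "\<dots> \<le> 1/100" using \<sigma>(1) by (simp add: field_simps)
    finally show ?thesis .
  qed

  note proj2 = projection_step[OF qr1(2) \<gamma>(1) \<gamma>1 q2(1)
      fl_mat_mult_unit_error[OF S\<^sub>2] fl_mat_mult_unit_error[OF P\<^sub>2] fl_mat_diff_unit_error[OF Y\<^sub>2],
      unfolded dims(1), OF dims(2,3) order_refl order_refl dims(3) dims(2) order_refl dims(3)]
  have S2small: "spnorm S\<^sub>2 \<le> 1/50"
  proof -
    have "spnorm (S\<^sub>2 - transpose Q\<^sub>1 ** Q\<^sub>2) \<le> \<gamma> * (spnorm (transpose Q\<^sub>1) * spnorm Q\<^sub>2)"
      using fl_mat_mult_unit_error[OF S\<^sub>2] dims by simp
    also have "\<dots> \<le> \<gamma> * (2 * 2)"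
      using q1 q2 \<gamma> by (intro mult_left_mono mult_mono) (auto simp: spnorm_nonneg)
    finally have "spnorm (S\<^sub>2 - transpose Q\<^sub>1 ** Q\<^sub>2) \<le> \<gamma> * 4" by simp
    from spnorm_add_le[OF this q12] \<gamma>(2) show ?thesis by simp
  qed
  have s3: "(0::real) < 1/4" by simp
  have lY2: "1/4 * norm x \<le> norm (Y\<^sub>2 *v x)" for x
  proof -
    have "Q\<^sub>2 *v x = Y\<^sub>2 *v x + (Q\<^sub>1 ** S\<^sub>2) *v x - (Y\<^sub>2 - (Q\<^sub>2 - Q\<^sub>1 ** S\<^sub>2)) *v x"
      by (simp add: algebra_simps)
    then have "norm (Q\<^sub>2 *v x) \<le> norm (Y\<^sub>2 *v x) + norm ((Q\<^sub>1 ** S\<^sub>2) *v x)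
        + norm ((Y\<^sub>2 - (Q\<^sub>2 - Q\<^sub>1 ** S\<^sub>2)) *v x)"
      by (metis (no_types, lifting) norm_triangle_ineq norm_triangle_ineq4 add_right_mono order_trans)
    moreover have "norm ((Q\<^sub>1 ** S\<^sub>2) *v x) \<le> 2 * (1/50) * norm x"
      using spnorm_mult_le[OF q1(1) S2small]
      by (intro order_trans[OF norm_matrix_vector_le] mult_right_mono) auto
    moreover have "norm ((Y\<^sub>2 - (Q\<^sub>2 - Q\<^sub>1 ** S\<^sub>2)) *v x) \<le> 1/100 * norm x"
      using proj2(2) \<gamma>(2) by (intro order_trans[OF norm_matrix_vector_le] mult_right_mono) auto
    ultimately show ?thesis using q2(2)[of x] norm_ge_zero[of x] by linarith
  qed

  have Y2n: "spnorm Y\<^sub>2 \<le> 20" using proj2(3) by simp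
  note qr3 = fl_thin_qr_unit_error[OF qr3 full_rank_of_lower_bound[OF s3 lY2] L(2)]
  have "\<gamma> * 20 \<le> 1/4 / 2" using \<gamma>(2) by simp
  note step3 = qr_step[OF s3 lY2 Y2n qr3(2,3) \<gamma>(1) \<gamma>1 this]
  have q3: "spnorm Q\<^sub>2' \<le> 2" using nearly_orthonormal_bounds(1)[OF qr3(2)] \<gamma>1 by auto
  have orth: "spnorm (transpose Q\<^sub>1 ** Q\<^sub>2') \<le> 1984 * \<gamma>"
  proof -
    have "spnorm (transpose Q\<^sub>1) * (\<gamma> * 20) \<le> 2 * (\<gamma> * 20)"
      using q1(2) \<gamma> by (intro mult_right_mono) auto
    then have "spnorm (transpose Q\<^sub>1 ** Y\<^sub>2) + spnorm (transpose Q\<^sub>1) * (\<gamma> * 20) \<le> 124 * \<gamma>"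
      using proj2(4) by linarith
    then have "spnorm (transpose Q\<^sub>1 ** Q\<^sub>2') \<le> 124 * \<gamma> * (4 / (1/4))"
      by (intro order_trans[OF step3(4)[of "transpose Q\<^sub>1"]] mult_right_mono) auto
    then show ?thesis by simp
  qed
  show "spnorm (mat 1 - transpose Q ** Q) \<le> 4000 * \<gamma>"
    using hcat_nearly_orthonormal[OF qr1(2) qr3(2) orth] \<gamma>(1) unfolding Q by simp

  have R2n: "spnorm R\<^sub>2 \<le> 40 * \<mu>" and R2bn: "spnorm R\<^sub>2b \<le> 80" using step2(2) step3(2) by auto
  have S2n: "spnorm S\<^sub>2 \<le> 8" using proj2(1) by simp
  have P3e: "spnorm (P\<^sub>3 - S\<^sub>2 ** R\<^sub>2) \<le> 320 * a"
  proof -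
    have "spnorm (P\<^sub>3 - S\<^sub>2 ** R\<^sub>2) \<le> \<gamma> * (spnorm S\<^sub>2 * spnorm R\<^sub>2)"
      using fl_mat_mult_unit_error[OF P\<^sub>3] dims by simp
    also have "\<dots> \<le> \<gamma> * (8 * (40 * \<mu>))"
      using S2n R2n \<gamma> by (intro mult_left_mono mult_mono) (auto simp: spnorm_nonneg)
    finally show ?thesis by (simp add: a_def)
  qed
  have P3n: "spnorm P\<^sub>3 \<le> 330 * \<mu>"
    using spnorm_add_le[OF P3e spnorm_mult_le[OF S2n R2n]] a\<mu> \<mu>0 by simp
  have S'e: "spnorm (S' - (S\<^sub>1 + P\<^sub>3)) \<le> 334 * a"
  proof -
    have "spnorm (S' - (S\<^sub>1 + P\<^sub>3)) \<le> \<gamma> * spnorm (S\<^sub>1 + P\<^sub>3)"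
      using fl_mat_add_unit_error[OF S'] dims by simp
    also have "\<dots> \<le> \<gamma> * (4 * \<mu> + 330 * \<mu>)"
      using spnorm_add_le[OF proj1(1) P3n] \<gamma> by (intro mult_left_mono) auto
    finally show ?thesis by (simp add: a_def algebra_simps)
  qed
  have R2'e: "spnorm (R\<^sub>2' - R\<^sub>2b ** R\<^sub>2) \<le> 3200 * a"
  proof -
    have "spnorm (R\<^sub>2' - R\<^sub>2b ** R\<^sub>2) \<le> \<gamma> * (spnorm R\<^sub>2b * spnorm R\<^sub>2)"
      using fl_mat_mult_unit_error[OF R\<^sub>2'] dims by simp
    also have "\<dots> \<le> \<gamma> * (80 * (40 * \<mu>))"
      using R2bn R2n \<gamma> by (intro mult_left_mono mult_mono) (auto simp: spnorm_nonneg)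
    finally show ?thesis by (simp add: a_def)
  qed
  \<comment> \<open>Telescoping: each summand is the local error of one step, multiplied by factors of norm
    \<open>O(1)\<close> or \<open>O(\<mu>)\<close>.\<close>
  have eq: "Q\<^sub>1 ** S' + Q\<^sub>2' ** R\<^sub>2' - M\<^sub>2
      = Q\<^sub>1 ** ((S' - (S\<^sub>1 + P\<^sub>3)) + (P\<^sub>3 - S\<^sub>2 ** R\<^sub>2)) + Q\<^sub>2' ** (R\<^sub>2' - R\<^sub>2b ** R\<^sub>2)
        + ((Q\<^sub>2' ** R\<^sub>2b - Y\<^sub>2) + (Y\<^sub>2 - (Q\<^sub>2 - Q\<^sub>1 ** S\<^sub>2))) ** R\<^sub>2
        + (Q\<^sub>2 ** R\<^sub>2 - Y\<^sub>1) + (Y\<^sub>1 - (M\<^sub>2 - Q\<^sub>1 ** S\<^sub>1))"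
    by (simp add: matrix_eq algebra_simps matrix_vector_mul_assoc[symmetric])
  have "spnorm (Q\<^sub>1 ** S' + Q\<^sub>2' ** R\<^sub>2' - M\<^sub>2)
      \<le> 2 * (334 * a + 320 * a) + 2 * (3200 * a) + (\<gamma> * 20 + 18 * (\<gamma> * 2)) * (40 * \<mu>) + 10 * a + 18 * a"
    unfolding eq
    by (intro spnorm_add_le spnorm_mult_le q1(1) q3 S'e P3e R2'e step3(1) proj2(2) R2n step2(1) proj1(2))
  then have res: "spnorm (Q\<^sub>1 ** S' + Q\<^sub>2' ** R\<^sub>2' - M\<^sub>2) \<le> 9976 * a"
    by (simp add: a_def algebra_simps)
  show "spnorm (Q ** R - hcat M\<^sub>1 M\<^sub>2) \<le> 10000 * (\<gamma> * \<mu>)"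
    using spnorm_hcat_le[OF step1(1) res] a0
    unfolding Q R hcat_mult_block_mat hcat_diff a_def[symmetric] by simp
  show "upper_triangular R"
    unfolding R using fl_mat_mult_upper_triangular[OF R\<^sub>2' \<epsilon> qr3(1) qr2(1)]
    by (rule upper_triangular_block_mat[OF qr1(1)])
qed

text \<open>The computed \<open>z\<close> solves \<open>(R + \<Delta>R) z = transpose Q f + \<dots>\<close> exactly. Multiplication by \<open>Q\<close> turns
  \<open>Q ** R\<close> into \<open>M\<close> up to the residual of the factorization and \<open>Q (transpose Q f)\<close> into \<open>f\<close> up to
  the defect of orthonormality, and it does not magnify the other errors.\<close>
lemma solve_backward_error:
  fixes M Q R :: "real^('l::{finite,linorder})^('l::{finite,linorder})"
  assumes Q: "spnorm (mat 1 - transpose Q ** Q) \<le> 4000 * \<gamma>"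
    and R: "upper_triangular R" and QR: "spnorm (Q ** R - M) \<le> 10000 * (\<gamma> * spnorm M)"
    and g: "fl_mat_vec \<epsilon> (transpose Q) f g" and z: "fl_back_subst \<epsilon> R g z"
    and dim: "CARD('l) = l" and \<epsilon>2: "\<epsilon> \<le> 1 / 2"
    and \<gamma>: "0 \<le> \<gamma>" "\<gamma> \<le> 1 / 10^5"
    and \<sigma>: "0 < \<sigma>" "\<And>w. \<sigma> * norm w \<le> norm (M *v w)"
    and small: "\<gamma> * spnorm M \<le> \<sigma> / 10^5"
  shows "\<exists>\<Delta>M \<Delta>f. (M + \<Delta>M) *v z = f + \<Delta>f \<and>
    spnorm \<Delta>M \<le> \<gamma> * 10008 * spnorm M \<and> norm \<Delta>f \<le> \<gamma> * 16010 * norm f"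
proof -
  let ?\<mu> = "spnorm M"
  have a: "\<gamma> * ?\<mu> \<le> ?\<mu> / 100000"
    using mult_right_mono[OF \<gamma>(2) spnorm_nonneg[of M]] by simp
  have q: "spnorm Q \<le> 2" "spnorm (transpose Q) \<le> 2" "\<And>x. norm x \<le> 2 * norm (Q *v x)"
    using nearly_orthonormal_bounds[OF Q] \<gamma>(2) by auto
  have QRn: "spnorm (Q ** R) \<le> 2 * ?\<mu>"
    using spnorm_add_le[OF QR order_refl[of ?\<mu>]] a spnorm_nonneg[of M] by simp
  have Rn: "spnorm R \<le> 4 * ?\<mu>"
  proof (rule spnorm_leI)
    fix x
    have "norm (R *v x) \<le> 2 * norm ((Q ** R) *v x)"
      using q(3)[of "R *v x"] by (simp add: matrix_vector_mul_assoc)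
    also have "\<dots> \<le> 2 * (2 * ?\<mu> * norm x)"
      using QRn by (intro mult_left_mono order_trans[OF norm_matrix_vector_le] mult_right_mono) auto
    finally show "norm (R *v x) \<le> 4 * ?\<mu> * norm x" by simp
  qed
  have "\<sigma> / 4 * norm x \<le> norm (R *v x)" for x
  proof -
    have "M *v x = Q *v (R *v x) - (Q ** R - M) *v x"
      by (simp add: algebra_simps matrix_vector_mul_assoc)
    then have "norm (M *v x) \<le> norm (Q *v (R *v x)) + norm ((Q ** R - M) *v x)"
      by (metis norm_triangle_ineq4)
    moreover have "norm (Q *v (R *v x)) \<le> 2 * norm (R *v x)"
      using q(1) by (intro order_trans[OF norm_matrix_vector_le] mult_right_mono) auto
    moreover have "norm ((Q ** R - M) *v x) \<le> \<sigma> / 2 * norm x"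
      using QR small \<sigma>(1) by (intro order_trans[OF norm_matrix_vector_le] mult_right_mono) auto
    ultimately show ?thesis using \<sigma>(2)[of x] by linarith
  qed
  then have "invertible R" using \<sigma>(1) by (intro invertible_of_lower_bound[of "\<sigma> / 4"]) auto
  note diag = upper_triangular_diag_nonzero[OF R this]
  obtain \<Delta>R \<Delta>g where Rz: "(R + \<Delta>R) *v z = g + \<Delta>g"
    and \<Delta>R: "spnorm \<Delta>R \<le> real CARD('l) * real CARD('l) * (2 ^ Suc CARD('l) * \<epsilon> * spnorm R)"
    and \<Delta>g: "norm \<Delta>g \<le> real CARD('l) * (2 ^ Suc CARD('l) * \<epsilon> * norm g)"
    by (rule fl_back_subst_error[OF z \<epsilon>(1) \<epsilon>2 R diag])
  have l1: "1 \<le> l" unfolding dim[symmetric] by (simp add: Suc_leI)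
  have \<Delta>R1: "spnorm \<Delta>R \<le> \<gamma> * (4 * ?\<mu>)"
    using \<Delta>R rounding_factor_scaled[of l l l "spnorm R"] mult_left_mono[OF Rn \<gamma>(1)]
    by (simp add: dim spnorm_nonneg)
  have g1: "norm (g - transpose Q *v f) \<le> \<gamma> * (2 * norm f)"
    using fl_mat_vec_unit_error[OF g] dim
      mult_left_mono[OF mult_right_mono[OF q(2) norm_ge_zero[of f]] \<gamma>(1)] by simp
  have g2: "norm g \<le> 3 * norm f"
  proof -
    have "norm g \<le> norm (g - transpose Q *v f) + norm (transpose Q *v f)"
      using norm_triangle_ineq[of "g - transpose Q *v f" "transpose Q *v f"] by simp
    moreover have "norm (transpose Q *v f) \<le> 2 * norm f"
      using q(2) by (intro order_trans[OF norm_matrix_vector_le] mult_right_mono) auto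
    moreover have "\<gamma> * (2 * norm f) \<le> 1 * norm f"
      using mult_right_mono[of \<gamma> "1/2" "2 * norm f"] \<gamma>(2) by simp
    ultimately show ?thesis using g1 by linarith
  qed
  have \<Delta>g1: "norm \<Delta>g \<le> \<gamma> * (3 * norm f)"
    using \<Delta>g rounding_factor_scaled[of l 1 l "norm g"] l1 mult_left_mono[OF g2 \<gamma>(1)]
    by (simp add: dim)
  define h where "h = Q *v (transpose Q *v f) - f"
  have h: "norm h \<le> 16000 * \<gamma> * norm f"
  proof -
    \<comment> \<open>\<open>Q\<close> is square, so \<open>f\<close> lies in its range and \<open>Q ** transpose Q - 1\<close> acts on \<open>f\<close> through
      \<open>transpose Q ** Q - 1\<close>.\<close>
    obtain u where u: "Q *v u = f" "norm u \<le> norm f / (1/2)"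
      by (rule preimage_of_lower_bound[of "1/2" Q f]) (use q(3) in \<open>auto simp: mult.commute\<close>)
    have "h = - (Q *v ((mat 1 - transpose Q ** Q) *v u))"
      unfolding h_def u(1)[symmetric]
      by (simp add: algebra_simps matrix_vector_mul_assoc[symmetric] del: transpose_matrix_vector)
    then have "norm h \<le> spnorm Q * norm ((mat 1 - transpose Q ** Q) *v u)"
      using norm_matrix_vector_le[of Q] by simp
    also have "\<dots> \<le> 2 * (4000 * \<gamma> * (norm f / (1/2)))"
      using q(1) Q u(2) \<gamma>(1)
      by (intro mult_mono order_trans[OF norm_matrix_vector_le]) (auto simp: spnorm_nonneg)
    finally show ?thesis by simp
  qed
  define \<Delta>M where "\<Delta>M = (Q ** R - M) + Q ** \<Delta>R"
  define \<Delta>f where "\<Delta>f = h + Q *v ((g - transpose Q *v f) + \<Delta>g)"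
  have "(M + \<Delta>M) *v z = Q *v ((R + \<Delta>R) *v z)"
    by (simp add: \<Delta>M_def algebra_simps matrix_vector_mul_assoc[symmetric])
  also have "\<dots> = f + \<Delta>f"
    unfolding Rz \<Delta>f_def h_def by (simp add: algebra_simps del: transpose_matrix_vector)
  finally have "(M + \<Delta>M) *v z = f + \<Delta>f" .
  moreover have "spnorm \<Delta>M \<le> \<gamma> * 10008 * ?\<mu>"
    using spnorm_add_le[OF QR spnorm_mult_le[OF q(1) \<Delta>R1]] unfolding \<Delta>M_def by simp
  moreover have "norm \<Delta>f \<le> \<gamma> * 16010 * norm f"
  proof -
    have "norm (Q *v ((g - transpose Q *v f) + \<Delta>g)) \<le> 2 * (\<gamma> * (2 * norm f) + \<gamma> * (3 * norm f))"
      using q(1) \<gamma>(1) by (intro order_trans[OF norm_matrix_vector_le] mult_mono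
          norm_triangle_le add_mono g1 \<Delta>g1) auto
    then have "norm (Q *v ((g - transpose Q *v f) + \<Delta>g)) \<le> 10 * (\<gamma> * norm f)" by simp
    then have "norm \<Delta>f \<le> 16000 * (\<gamma> * norm f) + 10 * (\<gamma> * norm f)"
      unfolding \<Delta>f_def using h by (intro norm_triangle_mono) auto
    then show ?thesis by (simp add: mult_ac)
  qed
  ultimately show ?thesis by blast
qed

end

section \<open>The saddle point matrix and the conclusion\<close>

text \<open>For a kernel vector \<open>(x, y)\<close> the two block rows combine to \<open>x \<bullet> A x + y \<bullet> C y = 0\<close>, whence
  \<open>x = 0\<close> by definiteness of \<open>A\<close>, then \<open>B y = 0\<close>, and \<open>y = 0\<close> because \<open>B\<close> has full column rank.\<close>
lemma saddle_point_invertible: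
  assumes A: "sym_pos_def A" and C: "sym_pos_semidef C" and B: "rank B = CARD('n)"
  shows "invertible (block_mat A (B :: real^'n^'m) (transpose B) (- C))"
proof -
  let ?M = "block_mat A B (transpose B) (- C)"
  have "w = 0" if "?M *v w = 0" for w
  proof -
    define x y where "x = upper_part w" and "y = lower_part w"
    have j: "join_vec (A *v x + B *v y) (transpose B *v x + (- C) *v y) = 0"
      using that by (simp add: block_mat_mult_vec x_def y_def)
    have z0: "upper_part (0 :: real^('m + 'n)) = 0" "lower_part (0 :: real^('m + 'n)) = 0"
      by (simp_all add: upper_part_def lower_part_def vec_eq_iff)
    have 1: "A *v x + B *v y = 0" using arg_cong[OF j, of upper_part] by (simp add: z0)
    have 2: "transpose B *v x = C *v y"
      using arg_cong[OF j, of lower_part] by (simp add: z0 uminus_matrix_vector_mult del: transpose_matrix_vector)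
    have "x \<bullet> (A *v x) = - (x \<bullet> (B *v y))"
      using arg_cong[OF 1, of "inner x"] by (simp add: inner_add_right eq_neg_iff_add_eq_0)
    also have "x \<bullet> (B *v y) = y \<bullet> (C *v y)"
      using inner_transpose[of B x y] by (simp only: 2 inner_commute)
    finally have "x \<bullet> (A *v x) \<le> 0" using C by (simp add: sym_pos_semidef_def)
    then have x0: "x = 0" using A by (metis not_le sym_pos_def_def)
    then have "B *v y = B *v 0" using 1 by simp
    then have "y = 0" using B by (meson full_rank_injective injD)
    then show "w = 0"
      using norm_parts_squared[of w] x0 by (simp add: x_def y_def)
  qed
  then show ?thesis
    by (metis invertible_left_inverse matrix_left_invertible_ker)
qed

lemma invertible_lower_bound:
  fixes M :: "real^'l^'l"
  assumes "invertible M"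
  shows "0 < spnorm (matrix_inv M)" "1 / spnorm (matrix_inv M) * norm w \<le> norm (M *v w)"
    "1 \<le> cond_num M"
proof -
  have inv: "matrix_inv M ** M = mat 1"
    using someI_ex[OF assms[unfolded invertible_def]] by (simp add: matrix_inv_def)
  have le: "norm w \<le> spnorm (matrix_inv M) * norm (M *v w)" for w
    using norm_matrix_vector_le[of "matrix_inv M" "M *v w"] inv by (simp add: matrix_vector_mul_assoc)
  define e :: "real^'l" where "e = axis undefined 1"
  have e: "norm e = 1" by (simp add: e_def)
  have "spnorm (matrix_inv M) \<noteq> 0" using le[of e] e by auto
  then show pos: "0 < spnorm (matrix_inv M)" using spnorm_nonneg[of "matrix_inv M"] by linarith
  show "1 / spnorm (matrix_inv M) * norm w \<le> norm (M *v w)"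
    using le[of w] pos by (simp add: field_simps)
  have "1 \<le> spnorm (matrix_inv M) * norm (M *v e)" using le[of e] e by simp
  also have "\<dots> \<le> spnorm (matrix_inv M) * spnorm M"
    using norm_matrix_vector_le[of M e] e by (simp add: mult_left_mono spnorm_nonneg)
  finally show "1 \<le> cond_num M" by (simp add: cond_num_def)
qed

theorem mainTheorem1:
  fixes L :: "nat \<Rightarrow> nat \<Rightarrow> real"
  assumes "CARD('m::{finite,linorder}) \<ge> CARD('n::{finite,linorder})"
  shows "\<exists>K c\<^sub>1 c\<^sub>2 :: real.
    \<forall>(A :: real^('m::{finite,linorder})^('m::{finite,linorder}))
      (B :: real^('n::{finite,linorder})^('m::{finite,linorder})) (C :: real^('n::{finite,linorder})^('n::{finite,linorder}))
      (f :: real^('m::{finite,linorder} + 'n::{finite,linorder})) (\<epsilon> :: real) M z.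
      sym_pos_def A \<longrightarrow> sym_pos_semidef C \<longrightarrow> rank B = CARD('n) \<longrightarrow>
      M = block_mat A B (transpose B) (- C) \<longrightarrow>
      \<epsilon> > 0 \<longrightarrow> \<epsilon> * K * cond_num M < 1 \<longrightarrow>
      fl_bcgs2_solve \<epsilon> L (vcat A (transpose B)) (vcat B (- C)) f z \<longrightarrow>
      (\<exists>\<Delta>M \<Delta>f. (M + \<Delta>M) *v z = f + \<Delta>f \<and>
        spnorm \<Delta>M \<le> \<epsilon> * c\<^sub>1 * spnorm M \<and> norm \<Delta>f \<le> \<epsilon> * c\<^sub>2 * norm f)"
proof -
  let ?l = "CARD('m + 'n)"
  define D where "D = rounding_factor ?l + \<bar>L ?l CARD('m)\<bar> + \<bar>L ?l CARD('n)\<bar>"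
  have l1: "1 \<le> ?l" by (simp add: Suc_leI)
  have rf: "2 \<le> rounding_factor ?l" using rounding_factor_ge[OF l1 l1 le0] by simp
  have D: "rounding_factor ?l \<le> D" "L ?l CARD('m) \<le> D" "L ?l CARD('n) \<le> D" "2 \<le> D"
    using rf by (auto simp: D_def)
  have main: "\<exists>\<Delta>M \<Delta>f. (M + \<Delta>M) *v z = f + \<Delta>f \<and>
        spnorm \<Delta>M \<le> \<epsilon> * (D * 10008) * spnorm M \<and> norm \<Delta>f \<le> \<epsilon> * (D * 16010) * norm f"
    if A: "sym_pos_def A" and C: "sym_pos_semidef C" and B: "rank B = CARD('n)"
      and M: "M = block_mat A B (transpose B) (- C)" and \<epsilon>: "0 < \<epsilon>"
      and small: "\<epsilon> * (10^5 * D) * cond_num M < 1"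
      and solve: "fl_bcgs2_solve \<epsilon> L (vcat A (transpose B)) (vcat B (- C)) f z"
    for A :: "real^('m::{finite,linorder})^('m::{finite,linorder})"
      and B :: "real^('n::{finite,linorder})^('m::{finite,linorder})"
      and C :: "real^('n::{finite,linorder})^('n::{finite,linorder})"
      and f z :: "real^('m::{finite,linorder} + 'n::{finite,linorder})" and M \<epsilon>
  proof -
    define \<gamma> where "\<gamma> = \<epsilon> * D"
    define \<sigma> where "\<sigma> = 1 / spnorm (matrix_inv M)"
    have "invertible M" unfolding M by (rule saddle_point_invertible[OF A C B])
    note inv = invertible_lower_bound[OF this]
    have \<sigma>: "0 < \<sigma>" "\<And>w. \<sigma> * norm w \<le> norm (M *v w)" using inv by (auto simp: \<sigma>_def)
    have hcat: "M = hcat (vcat A (transpose B)) (vcat B (- C))" by (simp add: M block_mat_def)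
    have \<gamma>0: "0 \<le> \<gamma>" using \<epsilon> D by (simp add: \<gamma>_def)
    have g\<kappa>: "\<gamma> * cond_num M \<le> 1 / 10^5" using small by (simp add: \<gamma>_def field_simps)
    have \<gamma>1: "\<gamma> \<le> 1 / 10^5" using mult_left_mono[OF inv(3) \<gamma>0] g\<kappa> by simp
    have \<epsilon>2: "\<epsilon> \<le> 1/2" using \<gamma>1 mult_left_mono[OF D(4) less_imp_le[OF \<epsilon>]] by (simp add: \<gamma>_def)
    have e0: "0 \<le> \<epsilon>" "\<epsilon> \<le> 1" using \<epsilon> \<epsilon>2 by auto
    have unit: "\<epsilon> * rounding_factor ?l \<le> \<gamma>" "\<epsilon> * L ?l CARD('m) \<le> \<gamma>" "\<epsilon> * L ?l CARD('n) \<le> \<gamma>"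
      unfolding \<gamma>_def using D e0 by (auto intro!: mult_left_mono)
    have \<gamma>\<mu>: "\<gamma> * spnorm M \<le> \<sigma> / 10^5"
      using g\<kappa> inv(1) by (simp add: cond_num_def \<sigma>_def field_simps)
    obtain Q R g where Q: "fl_bcgs2 \<epsilon> L (vcat A (transpose B)) (vcat B (- C)) Q R"
      and g: "fl_mat_vec \<epsilon> (transpose Q) f g" and z: "fl_back_subst \<epsilon> R g z"
      using solve by (auto simp: fl_bcgs2_solve_def)
    have dims: "CARD('m) \<le> ?l" "CARD('n) \<le> ?l" by simp_all
    note qr = fl_bcgs2_error[OF e0 unit(1) Q refl dims unit(2,3) \<gamma>0 \<gamma>1, folded hcat,
        OF \<sigma> order_refl \<gamma>\<mu>]
    show ?thesis
      using solve_backward_error[OF e0 unit(1) qr(2,1,3) g z refl \<epsilon>2 \<gamma>0 \<gamma>1 \<sigma> \<gamma>\<mu>]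
      by (simp add: \<gamma>_def mult.assoc)
  qed
  show ?thesis
    by (rule exI[of _ "10^5 * D"], rule exI[of _ "D * 10008"], rule exI[of _ "D * 16010"])
      (intro allI impI, erule (6) main)
qed

end
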